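(* Let $N\ge2$, let $\mathbf k=(k_1,\dots,k_N)$ be positive integers, and let $F\subseteq\mathcal E_N$. Suppose $\mu_{\mathbf k}(F)>0$, let $c(F)$ be the number of connected components of $\mathcal B(F)$, and put $q(F)=|F|-2N+c(F)$. Then $\nu_{F,\mathbf k}(m)$ ($m\ge1$) is the interior Ehrhart polynomial of $\mathcal T_F(\mathbf k)$, i.e. it counts the lattice points in the relative interior of $m\mathcal T_F(\mathbf k)$. In particular, it is a polynomial in $m$ of degree $q(F)$ and $$\nu_{F,\mathbf k}(m)=(-1)^{q(F)}L_{F,\mathbf k}(-m),$$ where $L_{F,\mathbf k}$ is the Ehrhart polynomial given by $L_{F,\mathbf k}(m)=|m\mathcal T_F(\mathbf k)\cap\mathbb Z^F|$ for integers $m\ge 1$. Its leading coefficient is the relative lattice volume of $\mathcal T_F(\mathbf k)$.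
   Context: Let $[N]=\{1,\dots,N\}$ and $\mathcal E_N=\{(j,i):1\le i,j\le N,\ j\ne i\}$, with $(j,i)$ written $j\to i$. For a positive integer vector $\mathbf k$, $\mathfrak E^\circ_{\mathbf k}(F)$ is the set of $a\in\mathbb Z_{\ge0}^{\mathcal E_N}$ with $a_e=0$ for $e\notin F$, $a_e>0$ for $e\in F$, $\sum_{j\ne i}a_{ji}=k_i$ for all $i$, and $\sum_{i\ne j}a_{ji}=k_j$ for all $j$. With $w_{\mathbf k}(a)=\prod_{i=1}^N\frac{k_i!}{\prod_{j\ne i}a_{ji}!}$, $\mu_{\mathbf k}(F)=\sum_{a\in\mathfrak E^\circ_{\mathbf k}(F)}w_{\mathbf k}(a)$. For $m\ge1$, $\nu_{F,\mathbf k}(m)=|\mathfrak E^\circ_{m\mathbf k}(F)|$. $\mathcal T_F(\mathbf k)=\{a\in\mathbb R_{\ge0}^F:\ \sum_{j:j\to i\in F}a_{ji}=k_i\ \forall i,\ \sum_{i:j\to i\in F}a_{ji}=k_j\ \forall j\}$. $\mathcal B(F)$ is the bipartite graph with vertex set $\{1_L,\dots,N_L,1_R,\dots,N_R\}$ and an edge $i_Lj_R$ for each $j\to i\in F$. Relative lattice volume is the volume within the affine span, normalized so that a fundamental cell of the lattice of integer points parallel to the affine span has volume $1$. *)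

theory Defs
  imports "HOL-Analysis.Analysis" "HOL-Computational_Algebra.Polynomial"
begin

text \<open>
  The vertex set is a finite type \<open>'n\<close>, so \<open>N = CARD('n)\<close>. The pair \<open>(j, i)\<close> is the
  edge from \<open>j\<close> to \<open>i\<close>.
\<close>

definition offdiag_edges :: "('n \<times> 'n) set" where
  "offdiag_edges = {(j, i). j \<noteq> i}"

definition pos_flows :: "('n::finite \<Rightarrow> nat) \<Rightarrow> ('n \<times> 'n) set \<Rightarrow> ('n \<times> 'n \<Rightarrow> nat) set" where
  "pos_flows k F = {a. (\<forall>e. e \<notin> F \<longrightarrow> a e = 0) \<and> (\<forall>e\<in>F. a e > 0) \<and>
     (\<forall>i. (\<Sum>j | j \<noteq> i. a (j, i)) = k i) \<and>
     (\<forall>j. (\<Sum>i | i \<noteq> j. a (j, i)) = k j)}"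

definition flow_weight :: "('n::finite \<Rightarrow> nat) \<Rightarrow> ('n \<times> 'n \<Rightarrow> nat) \<Rightarrow> real" where
  "flow_weight k a = (\<Prod>i\<in>UNIV. fact (k i) / (\<Prod>j | j \<noteq> i. fact (a (j, i))))"

definition mu :: "('n::finite \<Rightarrow> nat) \<Rightarrow> ('n \<times> 'n) set \<Rightarrow> real" where
  "mu k F = (\<Sum>a\<in>pos_flows k F. flow_weight k a)"

definition nu :: "('n::finite \<times> 'n) set \<Rightarrow> ('n \<Rightarrow> nat) \<Rightarrow> nat \<Rightarrow> nat" where
  "nu F k m = card (pos_flows (\<lambda>i. m * k i) F)"

text \<open>
  The space \<open>\<real>\<^sup>F\<close> is identified with the coordinate subspace of the vectors in
  \<^typ>\<open>real ^ ('n::finite \<times> 'n)\<close> that vanish outside \<open>F\<close>. Affine hull, relative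
  interior and lattice points do not depend on this embedding.
\<close>

definition flow_polytope :: "('n::finite \<times> 'n) set \<Rightarrow> ('n \<Rightarrow> nat) \<Rightarrow> (real ^ ('n \<times> 'n)) set" where
  "flow_polytope F k = {a. (\<forall>e. a $ e \<ge> 0) \<and> (\<forall>e. e \<notin> F \<longrightarrow> a $ e = 0) \<and>
     (\<forall>i. (\<Sum>j | (j, i) \<in> F. a $ (j, i)) = real (k i)) \<and>
     (\<forall>j. (\<Sum>i | (j, i) \<in> F. a $ (j, i)) = real (k j))}"

text \<open>\<open>Inl i\<close> is the left vertex and \<open>Inr j\<close> the right vertex of the bipartite graph.\<close>

definition bip_edges :: "('n \<times> 'n) set \<Rightarrow> (('n + 'n) \<times> ('n + 'n)) set" where
  "bip_edges F = {(Inl i, Inr j) | i j. (j, i) \<in> F}"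

text \<open>Components are the classes of mutual reachability; isolated vertices count.\<close>

definition num_components :: "('n \<times> 'n) set \<Rightarrow> nat" where
  "num_components F = card ((UNIV :: ('n + 'n) set) // (bip_edges F \<union> (bip_edges F)\<inverse>)\<^sup>*)"

definition q_dim :: "('n::finite \<times> 'n) set \<Rightarrow> int" where
  "q_dim F = int (card F) - 2 * int CARD('n) + int (num_components F)"

definition int_points :: "(real ^ 'd::finite) set" where
  "int_points = {x. \<forall>e. x $ e \<in> \<int>}"

definition dilate :: "nat \<Rightarrow> (real ^ 'd::finite) set \<Rightarrow> (real ^ 'd) set" where
  "dilate m P = (\<lambda>x. real m *\<^sub>R x) ` P"

definition parallel_lattice :: "(real ^ 'd::finite) set \<Rightarrow> (real ^ 'd) set" where
  "parallel_lattice P =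
     int_points \<inter> {x - y | x y. x \<in> affine hull P \<and> y \<in> affine hull P}"

definition lattice_basis :: "(real ^ 'd::finite) set \<Rightarrow> (real ^ 'd) set \<Rightarrow> bool" where
  "lattice_basis \<Lambda> B \<longleftrightarrow>
     independent B \<and> \<Lambda> = {\<Sum>b\<in>B. of_int (c b) *\<^sub>R b | c :: real ^ 'd \<Rightarrow> int. True}"

text \<open>
  Lebesgue measure in the affine coordinates given by a lattice basis \<open>B\<close> of
  the parallel lattice and an origin \<open>x\<^sub>0\<close> in \<open>P\<close>; thus the fundamental
  cell spanned by \<open>B\<close> has volume 1. Two bases differ by a unimodular
  matrix, so the value does not depend on the choices. It is the relative volume if the
  affine hull is rational (the parallel lattice then has full rank in it), as for flow
  polytopes. A single point has volume 1, since the product measure over the empty set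
  is a unit point mass.
\<close>

definition rel_lattice_volume :: "(real ^ 'd::finite) set \<Rightarrow> real" where
  "rel_lattice_volume P =
     (let B = (SOME B. lattice_basis (parallel_lattice P) B);
          x\<^sub>0 = (SOME x. x \<in> P);
          M = PiM B (\<lambda>_. lborel :: real measure)
      in measure M {t \<in> space M. x\<^sub>0 + (\<Sum>b\<in>B. t b *\<^sub>R b) \<in> P})"

end

theory Submission
  imports Defs
begin

text \<open>
  The lattice points of \<open>m\<close> times the polytope are the points of height \<open>m\<close> of the cone of all \<open>(x, m)\<close> such that
  \<open>x \<ge> 0\<close> is supported on \<open>F\<close> and has margins \<open>m k\<close>. Perturbing by a generic vector \<open>w\<close> turns
  cones into half-open cones: \<open>w\<close> in the interior gives the closed polytope and \<open>- w\<close> its relative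
  interior. The cone is cut along the hyperplanes \<open>x e = l m\<close>, \<open>l\<close> an integer, into cones over unit
  boxes. Every face of such a box contains a lattice point, since a flow with integral margins
  can be rounded up or down to an integral flow. As moreover every constraint takes only the values \<open>0\<close> and
  \<open>1\<close> at these points, pulling a lattice point \<open>v\<close> writes each lattice point uniquely as
  \<open>y + t v\<close> with an integer \<open>t \<ge> 0\<close> and \<open>y\<close> in a half-open facet. Replacing \<open>w\<close> by \<open>- w\<close> replaces
  \<open>\<Sum>t\<ge>0\<close> by \<open>\<Sum>t>0\<close>, so polynomiality and reciprocity both follow by induction on the dimension.
  The leading coefficient is found by counting small lattice cubes.
\<close>

subsection \<open>Pairs of counting functions satisfying reciprocity\<close>

text \<open>Closed cells overlap in faces. One global generic direction assigns every shared lattice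
  point to a single cell, so that counts simply add up, and the same cells serve for
  \<open>w\<close> and for \<open>- w\<close>. Genericity is required against every integer
  functional and not only against the walls, because a pulling step replaces \<open>w\<close> by its
  projection to a facet along \<open>v\<close>, and this stronger condition is inherited by the
  projection. The boxes are there because a flow polytope may be wide: a lattice point at distance
  greater than one from a facet would give pieces that are not unimodular. Cells of too small a
  dimension need no separate treatment, since for generic \<open>w\<close> the half-open version of
  such a cell is empty. The degree comes from the circulations, the vectors on \<open>F\<close> with
  zero margins, whose dimension follows from the rank of the incidence map of the bipartite graph.
  The positive flow provided by \<open>mu k F > 0\<close> is a lattice point in the relative
  interior; it fixes the direction of the perturbation and gives the room needed to compare lattice
  points with cubes.\<close>

lemma poly_antidifference:
  fixes p :: "real poly"
  assumes "\<forall>i\<ge>D. coeff p i = 0"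
  shows "\<exists>P. (\<forall>i\<ge>Suc D. coeff P i = 0) \<and> (\<forall>x. poly P x - poly P (x - 1) = poly p x)"
  using assms
proof (induction D arbitrary: p)
  case 0
  then have "p = 0" by (simp add: poly_eq_iff)
  then show ?case by (intro exI[of _ 0]) simp
next
  case (Suc D)
  \<comment> \<open>\<open>Q - R\<close> is the backward difference of \<open>Q\<close>. Its
    coefficient at degree \<open>D + 1\<close> cancels and the one at degree \<open>D\<close> is
    \<open>coeff p D\<close>, so subtracting it lowers the bound.\<close>
  define Q where "Q = monom (coeff p D / real (Suc D)) (Suc D)"
  define R where "R = smult (coeff p D / real (Suc D)) ([:-1, 1:] ^ Suc D)"
  have R: "poly R x = poly Q (x - 1)" for x
    unfolding R_def Q_def by (simp add: poly_monom algebra_simps)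
  have "\<forall>i\<ge>D. coeff (p - (Q - R)) i = 0"
  proof (intro allI impI)
    fix i assume i: "D \<le> i"
    consider "i = D" | "i = Suc D" | "i > Suc D" using i by linarith
    then show "coeff (p - (Q - R)) i = 0"
    proof cases
      case 1
      then show ?thesis unfolding Q_def R_def
        by (simp add: coeff_linear_poly_power del: power_Suc of_nat_Suc)
    next
      case 2
      then show ?thesis unfolding Q_def R_def using Suc.prems
        by (simp add: coeff_linear_poly_power del: power_Suc of_nat_Suc)
    next
      case 3
      then show ?thesis unfolding Q_def R_def using Suc.prems
        by (simp add: coeff_eq_0 degree_linear_power del: power_Suc of_nat_Suc)
    qed
  qed
  from Suc.IH[OF this] obtain P where P: "\<forall>i\<ge>Suc D. coeff P i = 0"
    "\<forall>x. poly P x - poly P (x - 1) = poly (p - (Q - R)) x" by blast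
  show ?case
  proof (intro exI[of _ "P + Q"] conjI allI impI)
    fix i assume "Suc (Suc D) \<le> i"
    then show "coeff (P + Q) i = 0" using P(1) by (simp add: Q_def)
  next
    fix x
    show "poly (P + Q) x - poly (P + Q) (x - 1) = poly p x"
      using P(2)[rule_format, of x] by (simp add: R)
  qed
qed

text \<open>
  The counting function \<open>f\<close> of a half-open polytope of dimension \<open>D - 1\<close> and the counting
  function \<open>g\<close> of the complementary half-open polytope. The condition at \<open>0\<close> makes the relation
  stable under passing to pyramids.
\<close>

definition ehrhart_pair :: "nat \<Rightarrow> (nat \<Rightarrow> nat) \<Rightarrow> (nat \<Rightarrow> nat) \<Rightarrow> bool" where
  "ehrhart_pair D f g \<longleftrightarrow> (\<exists>p :: real poly. (\<forall>i\<ge>D. coeff p i = 0) \<and>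
     poly p 0 = real (f 0) - (-1) ^ D * real (g 0) \<and>
     (\<forall>m\<ge>1. poly p (real m) = real (f m)) \<and>
     (\<forall>m\<ge>1. poly p (- real m) = - ((-1) ^ D) * real (g m)))"

lemma ehrhart_pair_zero: "ehrhart_pair D (\<lambda>_. 0) (\<lambda>_. 0)"
  unfolding ehrhart_pair_def by (intro exI[of _ 0]) simp

lemma ehrhart_pair_add:
  assumes "ehrhart_pair D f g" "ehrhart_pair D f' g'"
  shows "ehrhart_pair D (\<lambda>m. f m + f' m) (\<lambda>m. g m + g' m)"
proof -
  from assms obtain p q where
    "\<forall>i\<ge>D. coeff p i = 0" "poly p 0 = real (f 0) - (-1) ^ D * real (g 0)"
    "\<forall>m\<ge>1. poly p (real m) = real (f m)" "\<forall>m\<ge>1. poly p (- real m) = - ((-1) ^ D) * real (g m)"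
    "\<forall>i\<ge>D. coeff q i = 0" "poly q 0 = real (f' 0) - (-1) ^ D * real (g' 0)"
    "\<forall>m\<ge>1. poly q (real m) = real (f' m)" "\<forall>m\<ge>1. poly q (- real m) = - ((-1) ^ D) * real (g' m)"
    unfolding ehrhart_pair_def by auto
  then show ?thesis unfolding ehrhart_pair_def
    by (intro exI[of _ "p + q"]) (simp add: algebra_simps)
qed

lemma ehrhart_pair_sum:
  assumes "finite I" "\<And>i. i \<in> I \<Longrightarrow> ehrhart_pair D (f i) (g i)"
  shows "ehrhart_pair D (\<lambda>m. \<Sum>i\<in>I. f i m) (\<lambda>m. \<Sum>i\<in>I. g i m)"
  using assms
  by (induction I rule: finite_induct) (simp_all add: ehrhart_pair_zero ehrhart_pair_add)

text \<open>The map sending \<open>p(x)\<close> to \<open>- (-1)^D * p(-x)\<close> exchanges the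
  values at positive and negative arguments, and the condition at 0 is invariant under it.\<close>

lemma ehrhart_pair_swap:
  assumes "ehrhart_pair D f g"
  shows "ehrhart_pair D g f"
proof -
  from assms obtain p where p: "\<forall>i\<ge>D. coeff p i = 0"
    "poly p 0 = real (f 0) - (-1) ^ D * real (g 0)"
    "\<forall>m\<ge>1. poly p (real m) = real (f m)" "\<forall>m\<ge>1. poly p (- real m) = - ((-1) ^ D) * real (g m)"
    unfolding ehrhart_pair_def by auto
  define q where "q = smult (- ((-1) ^ D)) (pcompose p [:0, -1:])"
  have q: "poly q x = - ((-1) ^ D) * poly p (- x)" for x
    by (simp add: q_def poly_pcompose)
  have "coeff q i = 0" if "i \<ge> D" for i
    using p(1) that by (simp add: q_def coeff_pcompose_linear)
  then show ?thesis unfolding ehrhart_pair_def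
    using p by (intro exI[of _ q], cases "even D") (auto simp: q)
qed

text \<open>A point of height \<open>m\<close> in a pyramid is a base point of height
  \<open>i\<close> plus \<open>m - i\<close> copies of the apex; removing the base excludes
  \<open>i = m\<close>. The antidifference of \<open>p\<close> normalised by \<open>f 0\<close> at 0
  sums \<open>f\<close> upwards and \<open>g\<close> downwards. The condition at 0 is exactly what
  makes the first step down land on \<open>g 0\<close>.\<close>

lemma ehrhart_pair_pyramid:
  assumes "ehrhart_pair D f g"
  shows "ehrhart_pair (Suc D) (\<lambda>m. \<Sum>i\<le>m. f i) (\<lambda>m. \<Sum>i<m. g i)"
proof -
  from assms obtain p where p: "\<forall>i\<ge>D. coeff p i = 0"
    "poly p 0 = real (f 0) - (-1) ^ D * real (g 0)"
    "\<And>m. m\<ge>1 \<Longrightarrow> poly p (real m) = real (f m)"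
    "\<And>m. m\<ge>1 \<Longrightarrow> poly p (- real m) = - ((-1) ^ D) * real (g m)"
    unfolding ehrhart_pair_def by auto
  obtain P0 where P0: "\<forall>i\<ge>Suc D. coeff P0 i = 0" "\<forall>x. poly P0 x - poly P0 (x - 1) = poly p x"
    using poly_antidifference[OF p(1)] by blast
  define P where "P = P0 + [:real (f 0) - poly P0 0:]"
  have P: "coeff P i = 0" if "i \<ge> Suc D" for i
    using P0(1) that by (cases i) (auto simp: P_def)
  have Pd: "poly P x - poly P (x - 1) = poly p x" for x
    using P0(2) by (simp add: P_def)
  have Pz: "poly P 0 = real (f 0)" by (simp add: P_def)
  have 1: "poly P (real m) = real (\<Sum>i\<le>m. f i)" for m
  proof (induction m)
    case 0
    then show ?case by (simp add: Pz)
  next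
    case (Suc m)
    have "poly P (real (Suc m)) = poly P (real m) + poly p (real (Suc m))"
      using Pd[of "real (Suc m)"] by (simp add: algebra_simps)
    then show ?case using Suc p(3)[of "Suc m"] by simp
  qed
  have 2: "poly P (- real (Suc m)) = (-1) ^ D * real (\<Sum>i<Suc m. g i)" for m
  proof (induction m)
    case 0
    then show ?case using Pd[of 0] by (simp add: Pz p(2))
  next
    case (Suc m)
    have "poly P (- real (Suc (Suc m))) = poly P (- real (Suc m)) - poly p (- real (Suc m))"
      using Pd[of "- real (Suc m)"] by (simp add: algebra_simps)
    also have "\<dots> = (-1) ^ D * real (\<Sum>i<Suc m. g i) + (-1) ^ D * real (g (Suc m))"
      using p(4)[of "Suc m"] Suc by simp
    finally show ?case by (simp add: algebra_simps)
  qed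
  show ?thesis unfolding ehrhart_pair_def
  proof (intro exI[of _ P] conjI allI impI)
    fix m :: nat assume "1 \<le> m"
    then obtain n where "m = Suc n" by (cases m) auto
    then show "poly P (- real m) = - ((- 1) ^ Suc D) * real (\<Sum>i<m. g i)"
      using 2[of n] by simp
  qed (use P 1 Pz in auto)
qed

subsection \<open>Pulling triangulations of half-open cones\<close>

definition int_vecs :: "'a::euclidean_space set" where
  "int_vecs = {x. \<forall>b\<in>Basis. x \<bullet> b \<in> \<int>}"

lemma int_vecs_inner: "x \<in> int_vecs \<Longrightarrow> y \<in> int_vecs \<Longrightarrow> x \<bullet> y \<in> \<int>"
  unfolding int_vecs_def by (subst euclidean_inner) (auto intro!: Ints_sum)

lemma int_vecs_add: "x \<in> int_vecs \<Longrightarrow> y \<in> int_vecs \<Longrightarrow> x + y \<in> int_vecs"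
  and int_vecs_diff: "x \<in> int_vecs \<Longrightarrow> y \<in> int_vecs \<Longrightarrow> x - y \<in> int_vecs"
  and int_vecs_scaleR: "c \<in> \<int> \<Longrightarrow> x \<in> int_vecs \<Longrightarrow> c *\<^sub>R x \<in> int_vecs"
  unfolding int_vecs_def by (auto simp: inner_add_left inner_diff_left)

lemma int_vecs_zero: "0 \<in> int_vecs"
  by (simp add: int_vecs_def)

lemma Basis_subset_int_vecs: "Basis \<subseteq> int_vecs"
  unfolding int_vecs_def by (auto simp: inner_Basis)

text \<open>Nonnegativity of \<open>a + \<epsilon> * b\<close> for all sufficiently small
  \<open>\<epsilon> > 0\<close>, without a limit.\<close>

definition lex_nonneg :: "real \<Rightarrow> real \<Rightarrow> bool" where
  "lex_nonneg a b \<longleftrightarrow> a > 0 \<or> (a = 0 \<and> b \<ge> 0)"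

lemma lex_nonneg_add: "lex_nonneg a b \<Longrightarrow> lex_nonneg c d \<Longrightarrow> lex_nonneg (a + c) (b + d)"
  unfolding lex_nonneg_def by auto

lemma lex_nonneg_antisym: "lex_nonneg (a - c) (b - d) \<Longrightarrow> lex_nonneg (c - a) (d - b) \<Longrightarrow> a = c \<and> b = d"
  unfolding lex_nonneg_def by auto

lemma lex_nonneg_fst: "lex_nonneg a b \<Longrightarrow> a \<ge> 0"
  unfolding lex_nonneg_def by auto

lemma ex_lex_minimal:
  assumes "finite A" "A \<noteq> {}"
  shows "\<exists>a\<in>A. \<forall>b\<in>A. lex_nonneg (f b - f a) (g b - g a)"
proof -
  obtain a0 where a0: "a0 \<in> A" "\<And>b. b \<in> A \<Longrightarrow> f a0 \<le> f b"
    using arg_min_if_finite(1)[OF assms, of f] arg_min_least[OF assms, of _ f] by blast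
  let ?A = "{a\<in>A. f a = f a0}"
  have A: "finite ?A" "?A \<noteq> {}" using assms a0(1) by auto
  obtain a where a: "a \<in> ?A" "\<And>b. b \<in> ?A \<Longrightarrow> g a \<le> g b"
    using arg_min_if_finite(1)[OF A, of g] arg_min_least[OF A, of _ g] by blast
  show ?thesis
  proof (intro bexI[of _ a] ballI)
    fix b assume "b \<in> A"
    then show "lex_nonneg (f b - f a) (g b - g a)"
      using a0(2)[of b] a(1) a(2)[of b] unfolding lex_nonneg_def by force
  qed (use a in auto)
qed

text \<open>
  The points \<open>x\<close> of \<open>S\<close> for which \<open>x + \<epsilon> w\<close> satisfies all constraints \<open>\<phi> \<bullet> _ \<ge> 0\<close> for small
  \<open>\<epsilon> > 0\<close>: the facets through which \<open>w\<close> points outwards are removed.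
\<close>

definition half_open_cone :: "'a::euclidean_space set \<Rightarrow> 'a set \<Rightarrow> 'a \<Rightarrow> 'a set" where
  "half_open_cone \<Phi> S w = {x\<in>S. \<forall>\<phi>\<in>\<Phi>. lex_nonneg (\<phi> \<bullet> x) (\<phi> \<bullet> w)}"

text \<open>Functionals that vanish on all of \<open>S\<close> cannot be avoided. Applied to
  differences, the condition says that integer functionals with the same value at \<open>w\<close>
  agree on \<open>S\<close>, hence cut out the same facet.\<close>

definition generic_in :: "'a::euclidean_space set \<Rightarrow> 'a \<Rightarrow> bool" where
  "generic_in S w \<longleftrightarrow> w \<in> S \<and> (\<forall>\<psi>\<in>int_vecs. \<psi> \<bullet> w = 0 \<longrightarrow> (\<forall>x\<in>S. \<psi> \<bullet> x = 0))"

definition slice :: "'a::euclidean_space \<Rightarrow> 'a set \<Rightarrow> 'a set \<Rightarrow> 'a \<Rightarrow> nat \<Rightarrow> 'a set" where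
  "slice \<eta> \<Phi> S w m = {x \<in> half_open_cone \<Phi> S w \<inter> int_vecs. \<eta> \<bullet> x = real m}"

text \<open>
  The cone over a lattice polytope at height \<open>\<eta> = 1\<close> all of whose faces contain a lattice point
  and whose facets all have width one. Pulling a lattice point then triangulates it unimodularly.
\<close>

definition compressed_cone :: "'a::euclidean_space \<Rightarrow> 'a set \<Rightarrow> 'a set \<Rightarrow> bool" where
  "compressed_cone \<eta> \<Phi> S \<longleftrightarrow> subspace S \<and> \<eta> \<in> int_vecs \<and> finite \<Phi> \<and> \<Phi> \<subseteq> int_vecs \<and>
     (\<forall>x\<in>S. (\<forall>\<phi>\<in>\<Phi>. \<phi> \<bullet> x \<ge> 0) \<longrightarrow> x \<noteq> 0 \<longrightarrow> \<eta> \<bullet> x > 0) \<and>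
     (\<forall>m. finite {x \<in> S \<inter> int_vecs. (\<forall>\<phi>\<in>\<Phi>. \<phi> \<bullet> x \<ge> 0) \<and> \<eta> \<bullet> x = real m}) \<and>
     (\<forall>x\<in>S. (\<forall>\<phi>\<in>\<Phi>. \<phi> \<bullet> x \<ge> 0) \<longrightarrow> x \<noteq> 0 \<longrightarrow>
       (\<exists>v\<in>S \<inter> int_vecs. \<eta> \<bullet> v = 1 \<and> (\<forall>\<phi>\<in>\<Phi>. \<phi> \<bullet> v \<in> {0, 1} \<and> (\<phi> \<bullet> x = 0 \<longrightarrow> \<phi> \<bullet> v = 0))))"

text \<open>The lattice point supplied for \<open>x\<close> satisfies every equality that
  \<open>x\<close> satisfies, so it lies on the face with \<open>x\<close>. Keeping all of
  \<open>\<Phi>\<close>, including \<open>\<psi>\<close> itself, makes the notion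
  hereditary.\<close>

lemma compressed_cone_face:
  assumes "compressed_cone \<eta> \<Phi> S" "\<psi> \<in> \<Phi>"
  shows "compressed_cone \<eta> \<Phi> {x\<in>S. \<psi> \<bullet> x = 0}"
  unfolding compressed_cone_def
proof (intro conjI allI ballI impI)
  show "subspace {x\<in>S. \<psi> \<bullet> x = 0}"
    using assms unfolding compressed_cone_def subspace_def by (auto simp: inner_add_right)
  show "finite {x \<in> {x \<in> S. \<psi> \<bullet> x = 0} \<inter> int_vecs. (\<forall>\<phi>\<in>\<Phi>. 0 \<le> \<phi> \<bullet> x) \<and> \<eta> \<bullet> x = real m}" for m
    by (rule finite_subset[of _ "{x \<in> S \<inter> int_vecs. (\<forall>\<phi>\<in>\<Phi>. 0 \<le> \<phi> \<bullet> x) \<and> \<eta> \<bullet> x = real m}"])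
       (use assms in \<open>auto simp: compressed_cone_def\<close>)
  fix x assume x: "x \<in> {x\<in>S. \<psi> \<bullet> x = 0}" "\<forall>\<phi>\<in>\<Phi>. 0 \<le> \<phi> \<bullet> x" "x \<noteq> 0"
  then obtain v where "v \<in> S \<inter> int_vecs" "\<eta> \<bullet> v = 1"
    "\<forall>\<phi>\<in>\<Phi>. \<phi> \<bullet> v \<in> {0, 1} \<and> (\<phi> \<bullet> x = 0 \<longrightarrow> \<phi> \<bullet> v = 0)"
    using assms unfolding compressed_cone_def by auto
  then show "\<exists>v\<in>{x \<in> S. \<psi> \<bullet> x = 0} \<inter> int_vecs.
            \<eta> \<bullet> v = 1 \<and> (\<forall>\<phi>\<in>\<Phi>. \<phi> \<bullet> v \<in> {0, 1} \<and> (\<phi> \<bullet> x = 0 \<longrightarrow> \<phi> \<bullet> v = 0))"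
    using x assms(2) by (intro bexI[of _ v]) auto
qed (use assms in \<open>auto simp: compressed_cone_def\<close>)

lemma finite_slice:
  assumes "compressed_cone \<eta> \<Phi> S"
  shows "finite (slice \<eta> \<Phi> S w m)"
proof (rule finite_subset)
  show "slice \<eta> \<Phi> S w m \<subseteq> {x \<in> S \<inter> int_vecs. (\<forall>\<phi>\<in>\<Phi>. 0 \<le> \<phi> \<bullet> x) \<and> \<eta> \<bullet> x = real m}"
    by (auto simp: slice_def half_open_cone_def lex_nonneg_fst)
qed (use assms in \<open>simp add: compressed_cone_def\<close>)

lemma generic_in_uminus: "subspace S \<Longrightarrow> generic_in S w \<Longrightarrow> generic_in S (- w)"
  unfolding generic_in_def by (auto simp: subspace_neg)

text \<open>The value of \<open>\<theta>\<close> at the projected vector is the value at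
  \<open>w\<close> of \<open>\<theta> - (\<theta> \<bullet> v) *\<^sub>R \<psi>\<close>, which is
  again integral and agrees with \<open>\<theta>\<close> where \<open>\<psi>\<close>
  vanishes.\<close>

lemma generic_in_project:
  assumes "subspace S" "generic_in S w" "\<psi> \<in> int_vecs" "v \<in> S \<inter> int_vecs" "\<psi> \<bullet> v = 1"
  shows "generic_in {x\<in>S. \<psi> \<bullet> x = 0} (w - (\<psi> \<bullet> w) *\<^sub>R v)"
  unfolding generic_in_def
proof (intro conjI ballI impI)
  show "w - (\<psi> \<bullet> w) *\<^sub>R v \<in> {x\<in>S. \<psi> \<bullet> x = 0}"
    using assms by (auto simp: generic_in_def inner_diff_right intro!: subspace_diff subspace_scale)
next
  fix \<theta> x assume \<theta>: "\<theta> \<in> int_vecs" "\<theta> \<bullet> (w - (\<psi> \<bullet> w) *\<^sub>R v) = 0" and x: "x \<in> {x\<in>S. \<psi> \<bullet> x = 0}"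
  define \<theta>' where "\<theta>' = \<theta> - (\<theta> \<bullet> v) *\<^sub>R \<psi>"
  have "\<theta>' \<in> int_vecs" unfolding \<theta>'_def
    using assms \<theta> by (intro int_vecs_diff int_vecs_scaleR int_vecs_inner) auto
  moreover have "\<theta>' \<bullet> w = 0"
    using \<theta>(2) by (simp add: \<theta>'_def inner_diff_left inner_diff_right mult.commute)
  ultimately have "\<theta>' \<bullet> x = 0" using assms(2) x unfolding generic_in_def by auto
  then show "\<theta> \<bullet> x = 0" using x by (simp add: \<theta>'_def inner_diff_left)
qed

text \<open>
  Every \<open>x\<close> in the half-open cone is uniquely \<open>y + t v\<close> with \<open>y\<close> in a half-open facet not
  containing \<open>v\<close>; the facet and \<open>t\<close> are found by minimising \<open>(\<phi> \<bullet> x, \<phi> \<bullet> w)\<close> lexicographically.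
  The set \<open>\<Psi>\<close> represents these facets without repetition.
\<close>

lemma card_slice_pulling:
  assumes C: "compressed_cone \<eta> \<Phi> S" and w: "generic_in S w"
    and v: "v \<in> S \<inter> int_vecs" "\<eta> \<bullet> v = 1" "\<forall>\<phi>\<in>\<Phi>. \<phi> \<bullet> v \<in> {0, 1}"
    and \<Psi>: "\<Psi> \<subseteq> \<Phi>" "\<Psi> \<noteq> {}" "\<forall>\<psi>\<in>\<Psi>. \<psi> \<bullet> v = 1" "inj_on (\<lambda>\<psi>. \<psi> \<bullet> w) \<Psi>"
      "\<forall>\<phi>\<in>\<Phi>. \<phi> \<bullet> v = 1 \<longrightarrow> (\<exists>\<psi>\<in>\<Psi>. \<psi> \<bullet> w = \<phi> \<bullet> w)"
  shows "card (slice \<eta> \<Phi> S w m) = (\<Sum>\<psi>\<in>\<Psi>. \<Sum>t | t \<le> m \<and> (t = 0 \<longrightarrow> \<psi> \<bullet> w \<ge> 0).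
           card (slice \<eta> \<Phi> {x\<in>S. \<psi> \<bullet> x = 0} (w - (\<psi> \<bullet> w) *\<^sub>R v) (m - t)))"
proof -
  define Y where "Y = (\<lambda>\<psi>. slice \<eta> \<Phi> {x\<in>S. \<psi> \<bullet> x = 0} (w - (\<psi> \<bullet> w) *\<^sub>R v))"
  \<comment> \<open>\<open>t = 0\<close> means that the point lies in the facet of
    \<open>\<psi>\<close> itself, which belongs to the half-open cone only if \<open>w\<close> does
    not point outwards through it.\<close>
  define T where "T = (\<lambda>\<psi>. {t. t \<le> m \<and> (t = 0 \<longrightarrow> \<psi> \<bullet> w \<ge> 0)})"
  define I where "I = Sigma \<Psi> T"
  define h where "h = (\<lambda>((\<psi>::'a, t::nat), y). y + real t *\<^sub>R v)"
  define A where "A = Sigma I (\<lambda>(\<psi>, t). Y \<psi> (m - t))"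
  have S: "subspace S" and fin: "finite \<Phi>" and \<Phi>Z: "\<Phi> \<subseteq> int_vecs"
    and pos: "\<And>x. x \<in> S \<Longrightarrow> \<forall>\<phi>\<in>\<Phi>. \<phi> \<bullet> x \<ge> 0 \<Longrightarrow> x \<noteq> 0 \<Longrightarrow> \<eta> \<bullet> x > 0"
    using C by (auto simp: compressed_cone_def)
  have fin\<Psi>: "finite \<Psi>" using fin \<Psi>(1) finite_subset by blast
  have finT: "finite (T \<psi>)" for \<psi> by (auto simp: T_def)
  have finY: "finite (Y \<psi> n)" if "\<psi> \<in> \<Psi>" for \<psi> n
    unfolding Y_def using compressed_cone_face[OF C] \<Psi>(1) that by (intro finite_slice) auto
  have same: "\<phi> \<bullet> x = \<psi> \<bullet> x" if "\<phi> \<in> \<Phi>" "\<psi> \<in> \<Phi>" "\<phi> \<bullet> w = \<psi> \<bullet> w" "x \<in> S" for \<phi> \<psi> x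
  proof -
    have "\<phi> - \<psi> \<in> int_vecs" using \<Phi>Z that by (intro int_vecs_diff) auto
    then have "(\<phi> - \<psi>) \<bullet> x = 0"
      using w that unfolding generic_in_def by (auto simp: inner_diff_left)
    then show ?thesis by (simp add: inner_diff_left)
  qed
  \<comment> \<open>The two arguments are the values of \<open>\<phi>\<close> at \<open>y\<close>
    and at the projected \<open>w\<close>. As \<open>\<psi> \<bullet> x = t\<close>, this says that
    \<open>\<psi>\<close> is the lexicographic minimiser, so \<open>x\<close> determines both
    \<open>\<psi>\<close> and \<open>t\<close>.\<close>
  have lex: "lex_nonneg (\<phi> \<bullet> x - real t) (\<phi> \<bullet> w - \<psi> \<bullet> w)" "\<psi> \<bullet> x = real t"
    if "\<psi> \<in> \<Psi>" "y \<in> Y \<psi> n" "x = y + real t *\<^sub>R v" "\<phi> \<in> \<Psi>" for \<phi> \<psi> x y t n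
  proof -
    have y: "\<psi> \<bullet> y = 0" "lex_nonneg (\<phi> \<bullet> y) (\<phi> \<bullet> w - (\<psi> \<bullet> w) * (\<phi> \<bullet> v))"
      using that(2,4) \<Psi>(1) by (auto simp: Y_def slice_def half_open_cone_def inner_diff_right)
    show "\<psi> \<bullet> x = real t" using that(1,3) \<Psi>(3) y by (simp add: inner_add_right)
    show "lex_nonneg (\<phi> \<bullet> x - real t) (\<phi> \<bullet> w - \<psi> \<bullet> w)"
      using that(3,4) \<Psi>(3) y by (simp add: inner_add_right)
  qed
  have inj: "inj_on h A"
  proof (rule inj_onI)
    fix a b assume ab: "a \<in> A" "b \<in> A" "h a = h b"
    obtain \<psi> t y where a: "a = ((\<psi>, t), y)" by (metis surj_pair)
    obtain \<psi>' t' y' where b: "b = ((\<psi>', t'), y')" by (metis surj_pair)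
    have eq: "h ((\<psi>, t), y) = h ((\<psi>', t'), y')" using ab by (simp add: a b)
    from ab have 1: "\<psi> \<in> \<Psi>" "y \<in> Y \<psi> (m - t)" "\<psi>' \<in> \<Psi>" "y' \<in> Y \<psi>' (m - t')"
      by (auto simp: A_def I_def a b)
    define x where "x = y + real t *\<^sub>R v"
    have x': "x = y' + real t' *\<^sub>R v" using eq by (simp add: h_def x_def)
    note l1 = lex[OF 1(1,2) x_def] and l2 = lex[OF 1(3,4) x']
    have "lex_nonneg (real t' - real t) (\<psi>' \<bullet> w - \<psi> \<bullet> w)"
      "lex_nonneg (real t - real t') (\<psi> \<bullet> w - \<psi>' \<bullet> w)"
      using l1(1)[OF 1(3)] l2(1)[OF 1(1)] l1(2)[OF 1(1)] l2(2)[OF 1(1)] by simp_all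
    then have "real t' = real t \<and> \<psi>' \<bullet> w = \<psi> \<bullet> w" by (rule lex_nonneg_antisym)
    then have "t = t'" "\<psi> = \<psi>'" using \<Psi>(4) 1 by (auto simp: inj_on_def)
    then show "a = b" using x' x_def by (simp add: a b)
  qed
  have img: "h ` A = slice \<eta> \<Phi> S w m"
  proof (intro equalityI subsetI)
    fix x assume "x \<in> h ` A"
    then obtain \<psi> t y where 1: "\<psi> \<in> \<Psi>" "t \<in> T \<psi>" "y \<in> Y \<psi> (m - t)" and x: "x = y + real t *\<^sub>R v"
      by (auto simp: A_def I_def h_def)
    have y: "y \<in> S" "y \<in> int_vecs" "\<eta> \<bullet> y = real (m - t)"
      "\<forall>\<phi>\<in>\<Phi>. lex_nonneg (\<phi> \<bullet> y) (\<phi> \<bullet> w - (\<psi> \<bullet> w) * (\<phi> \<bullet> v))"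
      using 1 by (auto simp: Y_def slice_def half_open_cone_def inner_diff_right)
    have t: "lex_nonneg (real t) (\<psi> \<bullet> w)" "t \<le> m" using 1(2) by (auto simp: T_def lex_nonneg_def)
    have "lex_nonneg (\<phi> \<bullet> x) (\<phi> \<bullet> w)" if "\<phi> \<in> \<Phi>" for \<phi>
    proof (cases "\<phi> \<bullet> v = 0")
      case True
      then show ?thesis using y(4) that by (auto simp: x inner_add_right)
    next
      case False
      then have "\<phi> \<bullet> v = 1" using v(3) that by auto
      moreover have "lex_nonneg (\<phi> \<bullet> y) (\<phi> \<bullet> w - (\<psi> \<bullet> w) * (\<phi> \<bullet> v))" using y(4) that by blast
      ultimately show ?thesis using lex_nonneg_add[OF _ t(1)]
        by (fastforce simp: x inner_add_right)
    qed
    moreover have "x \<in> S" unfolding x using y v S by (auto intro!: subspace_add subspace_scale)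
    moreover have "x \<in> int_vecs" unfolding x using y v by (auto intro!: int_vecs_add int_vecs_scaleR)
    moreover have "\<eta> \<bullet> x = real m" using y t v by (simp add: x inner_add_right)
    ultimately show "x \<in> slice \<eta> \<Phi> S w m" by (auto simp: slice_def half_open_cone_def)
  next
    fix x assume "x \<in> slice \<eta> \<Phi> S w m"
    then have x: "x \<in> S" "x \<in> int_vecs" "\<eta> \<bullet> x = real m" "\<And>\<phi>. \<phi> \<in> \<Phi> \<Longrightarrow> lex_nonneg (\<phi> \<bullet> x) (\<phi> \<bullet> w)"
      by (auto simp: slice_def half_open_cone_def)
    obtain \<psi> where \<psi>: "\<psi> \<in> \<Psi>"
      "\<And>\<phi>. \<phi> \<in> \<Psi> \<Longrightarrow> lex_nonneg (\<phi> \<bullet> x - \<psi> \<bullet> x) (\<phi> \<bullet> w - \<psi> \<bullet> w)"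
      using ex_lex_minimal[OF fin\<Psi> \<Psi>(2), of "\<lambda>\<phi>. \<phi> \<bullet> x" "\<lambda>\<phi>. \<phi> \<bullet> w"] by blast
    have \<psi>\<Phi>: "\<psi> \<in> \<Phi>" "\<psi> \<bullet> v = 1" using \<psi> \<Psi> by auto
    have "\<psi> \<bullet> x \<in> \<int>" using \<psi>\<Phi> \<Phi>Z x by (intro int_vecs_inner) auto
    then obtain n where n: "\<psi> \<bullet> x = of_int n" by (auto elim: Ints_cases)
    have lt: "lex_nonneg (\<psi> \<bullet> x) (\<psi> \<bullet> w)" using x \<psi>\<Phi> by auto
    then have "n \<ge> 0" using n lex_nonneg_fst by fastforce
    define t where "t = nat n"
    have t: "\<psi> \<bullet> x = real t" using n \<open>n \<ge> 0\<close> by (simp add: t_def)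
    define y where "y = x - real t *\<^sub>R v"
    have yl: "lex_nonneg (\<phi> \<bullet> y) (\<phi> \<bullet> (w - (\<psi> \<bullet> w) *\<^sub>R v))" if \<phi>: "\<phi> \<in> \<Phi>" for \<phi>
    proof (cases "\<phi> \<bullet> v = 0")
      case True
      then show ?thesis using x \<phi> by (auto simp: y_def inner_diff_right)
    next
      case False
      then have 1: "\<phi> \<bullet> v = 1" using v(3) \<phi> by auto
      then obtain \<phi>' where \<phi>': "\<phi>' \<in> \<Psi>" "\<phi>' \<bullet> w = \<phi> \<bullet> w" using \<Psi>(5) \<phi> by blast
      then have "\<phi>' \<bullet> x = \<phi> \<bullet> x" using same[of \<phi>' \<phi> x] \<Psi>(1) \<phi> x by auto
      then show ?thesis using \<psi>(2)[OF \<phi>'(1)] \<phi>'(2) 1 t by (simp add: y_def inner_diff_right)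
    qed
    have yS: "y \<in> S" unfolding y_def using x v S by (auto intro!: subspace_diff subspace_scale)
    have yZ: "y \<in> int_vecs" unfolding y_def using x v by (auto intro!: int_vecs_diff int_vecs_scaleR)
    have y\<eta>: "\<eta> \<bullet> y = real m - real t" using v x by (simp add: y_def inner_diff_right)
    \<comment> \<open>The remainder \<open>y\<close> still lies in the closed cone, where heights
      are nonnegative; this is what bounds \<open>t\<close> by \<open>m\<close>.\<close>
    have "\<eta> \<bullet> y \<ge> 0" using pos[OF yS] yl lex_nonneg_fst by (cases "y = 0") fastforce+
    then have tm: "t \<le> m" using y\<eta> by simp
    have "y \<in> Y \<psi> (m - t)"
      using yl yS yZ y\<eta> tm \<psi>\<Phi> t by (auto simp: Y_def slice_def half_open_cone_def y_def inner_diff_right)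
    moreover have "t \<in> T \<psi>" using tm lt t by (auto simp: T_def lex_nonneg_def)
    ultimately have "((\<psi>, t), y) \<in> A" using \<psi> by (simp add: A_def I_def)
    moreover have "h ((\<psi>, t), y) = x" by (simp add: h_def y_def)
    ultimately show "x \<in> h ` A" by (metis imageI)
  qed
  have "card (slice \<eta> \<Phi> S w m) = card A" using card_image[OF inj] img by simp
  also have "\<dots> = (\<Sum>(\<psi>, t)\<in>I. card (Y \<psi> (m - t)))"
    unfolding A_def by (subst card_SigmaI) (auto simp: I_def fin\<Psi> finT finY case_prod_beta)
  also have "\<dots> = (\<Sum>\<psi>\<in>\<Psi>. \<Sum>t\<in>T \<psi>. card (Y \<psi> (m - t)))"
    unfolding I_def by (subst sum.Sigma) (auto simp: fin\<Psi> finT)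
  finally show ?thesis unfolding T_def Y_def .
qed

lemma sum_reindex_le: "(\<Sum>t | t \<le> (m::nat) \<and> (t = 0 \<longrightarrow> r). f (m - t)) = (if r then \<Sum>i\<le>m. f i else \<Sum>i<m. f i)"
proof -
  have "(\<Sum>t | t \<le> m \<and> (t = 0 \<longrightarrow> r). f (m - t)) = (\<Sum>i\<in>(if r then {..m} else {..<m}). f i)"
    by (rule sum.reindex_bij_witness[of _ "\<lambda>i. m - i" "\<lambda>t. m - t"]) (auto split: if_splits)
  then show ?thesis by simp
qed

lemma dim_hyperplane_section:
  fixes \<psi> :: "'a::euclidean_space"
  assumes "subspace S" "v \<in> S" "\<psi> \<bullet> v \<noteq> 0"
  shows "Suc (dim {x\<in>S. \<psi> \<bullet> x = 0}) = dim S"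
proof -
  let ?H = "{x\<in>S. \<psi> \<bullet> x = 0}"
  have H: "subspace ?H" using assms unfolding subspace_def by (auto simp: inner_add_right)
  have "v \<notin> span ?H" using assms unfolding span_eq_iff[THEN iffD2, OF H] by simp
  then have "dim (insert v ?H) = Suc (dim ?H)" by (simp add: dim_insert)
  moreover have "span (insert v ?H) = S"
  proof
    show "span (insert v ?H) \<subseteq> S" using assms by (intro span_minimal) auto
    show "S \<subseteq> span (insert v ?H)"
    proof
      fix x assume x: "x \<in> S"
      define c where "c = (\<psi> \<bullet> x) / (\<psi> \<bullet> v)"
      have "x - c *\<^sub>R v \<in> ?H" using assms x
        by (auto simp: c_def inner_diff_right intro!: subspace_diff subspace_scale)
      then have "(x - c *\<^sub>R v) + c *\<^sub>R v \<in> span (insert v ?H)"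
        by (intro span_add span_scale span_base) auto
      then show "x \<in> span (insert v ?H)" by simp
    qed
  qed
  ultimately show ?thesis by (metis dim_span)
qed

text \<open>The same \<open>v\<close> and \<open>\<Psi>\<close> are used for \<open>w\<close> and
  \<open>- w\<close>, so both counts are sums over pyramids on the same facets. The sign of
  \<open>\<psi> \<bullet> w\<close>, never 0 by genericity, tells which of the two pyramids contains
  its base.\<close>

lemma ehrhart_pair_slice:
  assumes "compressed_cone \<eta> \<Phi> S" "generic_in S w"
  shows "ehrhart_pair (dim S) (\<lambda>m. card (slice \<eta> \<Phi> S w m)) (\<lambda>m. card (slice \<eta> \<Phi> S (- w) m))"
  using assms
proof (induction "dim S" arbitrary: S w)
  case 0
  then have "subspace S" by (simp add: compressed_cone_def)
  then have S: "S = {0}" using 0 by (metis dim_eq_0 subset_singletonD subspace_0 empty_iff)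
  then have "w = 0" using 0 by (simp add: generic_in_def)
  \<comment> \<open>Both counts are 1 at height 0 and 0 above it. They cancel in the condition at 0,
    so the zero polynomial serves.\<close>
  then have "slice \<eta> \<Phi> S w m = (if m = 0 then {0} else {})"
    "slice \<eta> \<Phi> S (- w) m = (if m = 0 then {0} else {})" for m
    by (auto simp: slice_def half_open_cone_def S lex_nonneg_def int_vecs_zero)
  then show ?case by (auto simp: ehrhart_pair_def S intro!: exI[of _ "0 :: real poly"])
next
  case (Suc D)
  note C = \<open>compressed_cone \<eta> \<Phi> S\<close> and w = \<open>generic_in S w\<close>
  have S: "subspace S" and fin: "finite \<Phi>" and \<Phi>Z: "\<Phi> \<subseteq> int_vecs"
    and pos: "\<And>x. x \<in> S \<Longrightarrow> \<forall>\<phi>\<in>\<Phi>. \<phi> \<bullet> x \<ge> 0 \<Longrightarrow> x \<noteq> 0 \<Longrightarrow> \<eta> \<bullet> x > 0"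
    using C by (auto simp: compressed_cone_def)
  show ?case
  proof (cases "\<exists>x\<in>S. (\<forall>\<phi>\<in>\<Phi>. \<phi> \<bullet> x \<ge> 0) \<and> x \<noteq> 0")
    case False
    \<comment> \<open>The closed cone is \<open>{0}\<close> although \<open>S\<close> is not. A
      point of the half-open cone would be 0, which puts \<open>u\<close> into the closed cone; then
      \<open>u = 0\<close> contradicts genericity. Even the slice at height 0 is empty.\<close>
    have "slice \<eta> \<Phi> S u m = {}" if u: "generic_in S u" for u m
    proof (rule ccontr)
      assume "slice \<eta> \<Phi> S u m \<noteq> {}"
      then obtain x where x: "x \<in> S" "\<forall>\<phi>\<in>\<Phi>. lex_nonneg (\<phi> \<bullet> x) (\<phi> \<bullet> u)"
        by (auto simp: slice_def half_open_cone_def)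
      then have "x = 0" using False lex_nonneg_fst by blast
      then have "\<forall>\<phi>\<in>\<Phi>. \<phi> \<bullet> u \<ge> 0" using x(2) by (auto simp: lex_nonneg_def)
      then have "u = 0" using False u by (auto simp: generic_in_def)
      then have "\<forall>b\<in>Basis. \<forall>x\<in>S. b \<bullet> x = 0"
        using u Basis_subset_int_vecs by (auto simp: generic_in_def)
      then have "S \<subseteq> {0}" by (metis euclidean_all_zero_iff inner_commute insert_iff subsetI)
      then show False using Suc(2) by (metis dim_eq_0 nat.distinct(1))
    qed
    then show ?thesis using w generic_in_uminus[OF S w] by (simp add: ehrhart_pair_zero)
  next
    case True
    then obtain v where v: "v \<in> S \<inter> int_vecs" "\<eta> \<bullet> v = 1" "\<forall>\<phi>\<in>\<Phi>. \<phi> \<bullet> v \<in> {0, 1}"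
      using C unfolding compressed_cone_def by meson
    let ?\<Phi>v = "{\<phi>\<in>\<Phi>. \<phi> \<bullet> v = 1}"
    obtain \<Psi> where \<Psi>: "\<Psi> \<subseteq> ?\<Phi>v" "inj_on (\<lambda>\<psi>. \<psi> \<bullet> w) \<Psi>" "(\<lambda>\<psi>. \<psi> \<bullet> w) ` ?\<Phi>v = (\<lambda>\<psi>. \<psi> \<bullet> w) ` \<Psi>"
      using subset_image_inj[of "(\<lambda>\<psi>. \<psi> \<bullet> w) ` ?\<Phi>v" "\<lambda>\<psi>. \<psi> \<bullet> w" ?\<Phi>v] by auto
    have ne: "\<Psi> \<noteq> {}"
    proof
      assume "\<Psi> = {}"
      \<comment> \<open>If no constraint is positive at \<open>v\<close>, then \<open>- v\<close>
        also lies in the cone, but at negative height.\<close>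
      then have "\<forall>\<phi>\<in>\<Phi>. \<phi> \<bullet> v = 0" using \<Psi>(3) v(3) by auto
      moreover have "v \<noteq> 0" using v(2) by auto
      ultimately have "\<eta> \<bullet> (- v) > 0" using pos[of "- v"] v S by (auto simp: subspace_neg)
      then show False using v by simp
    qed
    have fin\<Psi>: "finite \<Psi>" using fin \<Psi>(1) finite_subset[of \<Psi> \<Phi>] by auto
    have \<Psi>': "\<Psi> \<subseteq> \<Phi>" "\<forall>\<psi>\<in>\<Psi>. \<psi> \<bullet> v = 1"
      "\<forall>\<phi>\<in>\<Phi>. \<phi> \<bullet> v = 1 \<longrightarrow> (\<exists>\<psi>\<in>\<Psi>. \<psi> \<bullet> w = \<phi> \<bullet> w)"
      subgoal using \<Psi>(1) by blast
      subgoal using \<Psi>(1) by blast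
      subgoal
      proof (intro ballI impI)
        fix \<phi> assume "\<phi> \<in> \<Phi>" "\<phi> \<bullet> v = 1"
        then have "\<phi> \<bullet> w \<in> (\<lambda>\<psi>. \<psi> \<bullet> w) ` \<Psi>" unfolding \<Psi>(3)[symmetric] by simp
        then show "\<exists>\<psi>\<in>\<Psi>. \<psi> \<bullet> w = \<phi> \<bullet> w" by force
      qed
      done
    define f where "f = (\<lambda>\<psi> m. card (slice \<eta> \<Phi> {x\<in>S. \<psi> \<bullet> x = 0} (w - (\<psi> \<bullet> w) *\<^sub>R v) m))"
    define g where "g = (\<lambda>\<psi> m. card (slice \<eta> \<Phi> {x\<in>S. \<psi> \<bullet> x = 0} (- (w - (\<psi> \<bullet> w) *\<^sub>R v)) m))"
    have IH: "ehrhart_pair D (f \<psi>) (g \<psi>)" if "\<psi> \<in> \<Psi>" for \<psi>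
    proof -
      have 1: "Suc (dim {x\<in>S. \<psi> \<bullet> x = 0}) = dim S"
        using dim_hyperplane_section[OF S, of v \<psi>] v \<Psi>'(2) that by auto
      then have D: "D = dim {x\<in>S. \<psi> \<bullet> x = 0}" using Suc(2) by simp
      have "\<psi> \<in> \<Phi>" "\<psi> \<in> int_vecs" "\<psi> \<bullet> v = 1" using \<Psi>' that \<Phi>Z by auto
      then show ?thesis unfolding f_def g_def
        using Suc(1)[OF D compressed_cone_face[OF C] generic_in_project[OF S w _ v(1)]] D by simp
    qed
    have nz: "\<psi> \<bullet> w \<noteq> 0" if "\<psi> \<in> \<Psi>" for \<psi>
    proof
      assume "\<psi> \<bullet> w = 0"
      moreover have "\<psi> \<in> int_vecs" using that \<Psi>' \<Phi>Z by auto
      ultimately have "\<psi> \<bullet> v = 0" using w v(1) by (simp add: generic_in_def)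
      then show False using \<Psi>' that by simp
    qed
    have 1: "card (slice \<eta> \<Phi> S w m) = (\<Sum>\<psi>\<in>\<Psi>. if \<psi> \<bullet> w \<ge> 0 then \<Sum>i\<le>m. f \<psi> i else \<Sum>i<m. f \<psi> i)" for m
      unfolding card_slice_pulling[OF C w v \<Psi>'(1) ne \<Psi>'(2) \<Psi>(2) \<Psi>'(3)]
      by (rule sum.cong[OF refl], subst sum_reindex_le[symmetric]) (simp add: f_def)
    have inj': "inj_on (\<lambda>\<psi>. \<psi> \<bullet> (- w)) \<Psi>" using \<Psi>(2) by (simp add: inj_on_def)
    have ex': "\<forall>\<phi>\<in>\<Phi>. \<phi> \<bullet> v = 1 \<longrightarrow> (\<exists>\<psi>\<in>\<Psi>. \<psi> \<bullet> (- w) = \<phi> \<bullet> (- w))" using \<Psi>'(3) by simp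
    have 2: "card (slice \<eta> \<Phi> S (- w) m) = (\<Sum>\<psi>\<in>\<Psi>. if \<psi> \<bullet> w \<ge> 0 then \<Sum>i<m. g \<psi> i else \<Sum>i\<le>m. g \<psi> i)" for m
      unfolding card_slice_pulling[OF C generic_in_uminus[OF S w] v \<Psi>'(1) ne \<Psi>'(2) inj' ex']
    proof (rule sum.cong[OF refl])
      fix \<psi> assume "\<psi> \<in> \<Psi>"
      then have *: "\<psi> \<bullet> (- w) \<ge> 0 \<longleftrightarrow> \<not> \<psi> \<bullet> w \<ge> 0" using nz[of \<psi>] by auto
      have "- w - (\<psi> \<bullet> - w) *\<^sub>R v = - (w - (\<psi> \<bullet> w) *\<^sub>R v)" by simp
      then show "(\<Sum>t | t \<le> m \<and> (t = 0 \<longrightarrow> 0 \<le> \<psi> \<bullet> - w).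
          card (slice \<eta> \<Phi> {x \<in> S. \<psi> \<bullet> x = 0} (- w - (\<psi> \<bullet> - w) *\<^sub>R v) (m - t))) =
          (if 0 \<le> \<psi> \<bullet> w then \<Sum>i<m. g \<psi> i else \<Sum>i\<le>m. g \<psi> i)"
        using sum_reindex_le[of "g \<psi>" m "\<psi> \<bullet> (- w) \<ge> 0"] unfolding * g_def by simp
    qed
    show ?thesis unfolding 1 2 \<open>Suc D = dim S\<close>[symmetric]
    proof (rule ehrhart_pair_sum[OF fin\<Psi>])
      fix \<psi> assume "\<psi> \<in> \<Psi>"
      note p = IH[OF this]
      \<comment> \<open>For \<open>\<psi> \<bullet> w < 0\<close> the base belongs to the pyramid
        for \<open>- w\<close>, so the pair is swapped before and after forming the pyramid.\<close>
      show "ehrhart_pair (Suc D) (\<lambda>m. if \<psi> \<bullet> w \<ge> 0 then \<Sum>i\<le>m. f \<psi> i else \<Sum>i<m. f \<psi> i)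
         (\<lambda>m. if \<psi> \<bullet> w \<ge> 0 then \<Sum>i<m. g \<psi> i else \<Sum>i\<le>m. g \<psi> i)"
        using ehrhart_pair_pyramid[OF p] ehrhart_pair_swap[OF ehrhart_pair_pyramid[OF ehrhart_pair_swap[OF p]]]
        by (cases "\<psi> \<bullet> w \<ge> 0") simp_all
    qed
  qed
qed

subsection \<open>Generic vectors\<close>

lemma countable_int_vecs: "countable (int_vecs :: 'a::euclidean_space set)"
proof -
  define h where "h = (\<lambda>f :: 'a \<Rightarrow> int. \<Sum>b\<in>Basis. of_int (f b) *\<^sub>R b)"
  have "int_vecs \<subseteq> h ` (Basis \<rightarrow>\<^sub>E UNIV)"
  proof
    fix x :: 'a assume x: "x \<in> int_vecs"
    define f where "f = restrict (\<lambda>b. \<lfloor>x \<bullet> b\<rfloor>) Basis"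
    have "h f = (\<Sum>b\<in>Basis. (x \<bullet> b) *\<^sub>R b)"
      using x unfolding h_def f_def int_vecs_def by (intro sum.cong) (auto elim!: Ints_cases)
    then have "x = h f" by (simp add: euclidean_representation)
    then show "x \<in> h ` (Basis \<rightarrow>\<^sub>E UNIV)" by (auto simp: f_def)
  qed
  moreover have "countable (h ` (Basis \<rightarrow>\<^sub>E UNIV))"
    by (intro countable_image countable_PiE) auto
  ultimately show ?thesis by (rule countable_subset)
qed

text \<open>
  Along the curve \<open>x\<^sub>0 + s b\<^sub>1 + s\<^sup>2 b\<^sub>2 + \<dots>\<close> every integer functional that is not
  identically zero on \<open>S\<close> vanishes only finitely often, and there are countably many of them.
\<close>

lemma ex_generic_near:
  fixes S :: "'a::euclidean_space set"
  assumes S: "subspace S" and x0: "x0 \<in> S" and e: "e > 0"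
  shows "\<exists>w. generic_in S w \<and> norm (w - x0) < e"
proof -
  obtain B where B: "B \<subseteq> S" "finite B" "S \<subseteq> span B"
    using basis_exists[of S] finiteI_independent by metis
  obtain b and n :: nat where b: "B = b ` {..<n}"
    using finite_imp_nat_seg_image_inj_on[OF B(2)] by (metis lessThan_def)
  define w where "w = (\<lambda>s::real. x0 + (\<Sum>i<n. (s ^ Suc i) *\<^sub>R b i))"
  define p where "p = (\<lambda>\<psi>. [:\<psi> \<bullet> x0:] + (\<Sum>i<n. monom (\<psi> \<bullet> b i) (Suc i)))"
  have p: "poly (p \<psi>) s = \<psi> \<bullet> w s" for \<psi> s
    by (simp add: p_def w_def inner_add_right inner_sum_right poly_sum poly_monom mult.commute)
  let ?Z = "{\<psi>\<in>int_vecs. \<exists>x\<in>S. \<psi> \<bullet> x \<noteq> 0}"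
  have fin: "finite {s. poly (p \<psi>) s = 0}" if "\<psi> \<in> ?Z" for \<psi>
  proof (rule poly_roots_finite, rule notI)
    assume 0: "p \<psi> = 0"
    have "\<psi> \<bullet> b j = 0" if "j < n" for j
    proof -
      have "coeff (p \<psi>) (Suc j) = \<psi> \<bullet> b j"
        using that by (simp add: p_def coeff_sum)
      then show ?thesis using 0 by simp
    qed
    then have "\<forall>x\<in>B. orthogonal \<psi> x" by (auto simp: b orthogonal_def)
    then have "\<forall>x\<in>S. orthogonal \<psi> x" using B(3) orthogonal_to_span by (metis subsetD)
    then show False using that by (auto simp: orthogonal_def)
  qed
  define bad where "bad = (\<Union>\<psi>\<in>?Z. {s. poly (p \<psi>) s = 0})"
  have "countable bad" unfolding bad_def
    using countable_subset[OF _ countable_int_vecs, of ?Z] fin by (intro countable_UN) (auto intro: countable_finite)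
  moreover have "(w \<longlongrightarrow> w 0) (at_right 0)"
    unfolding w_def by (intro tendsto_intros)
  then have "\<forall>\<^sub>F s in at_right 0. norm (w s - x0) < e"
    using e tendstoD[of w x0 "at_right 0" e] by (simp add: w_def dist_norm)
  then obtain \<delta> where \<delta>: "\<delta> > 0" "\<And>s. 0 < s \<Longrightarrow> s < \<delta> \<Longrightarrow> norm (w s - x0) < e"
    unfolding eventually_at_right_field by auto
  ultimately have "\<not> {0<..<\<delta>} \<subseteq> bad"
    using uncountable_open_interval[of 0 \<delta>] countable_subset by auto
  then obtain s where s: "0 < s" "s < \<delta>" "s \<notin> bad" by (meson greaterThanLessThan_iff subsetI)
  have "w s \<in> S" unfolding w_def using S x0 B(1) b
    by (intro subspace_add subspace_sum subspace_scale) auto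
  then have "generic_in S (w s)"
    using s(3) unfolding generic_in_def bad_def by (auto simp: p)
  then show ?thesis using \<delta>(2)[OF s(1,2)] by blast
qed

subsection \<open>Rounding of flows\<close>

text \<open>Rank-nullity relative to \<open>S\<close>: \<open>f\<close> is injective on the
  orthogonal complement of its kernel in \<open>S\<close>, and that complement has the same image as
  \<open>S\<close>.\<close>

lemma dim_kernel_image:
  fixes f :: "'a::euclidean_space \<Rightarrow> 'b::euclidean_space"
  assumes f: "linear f" and S: "subspace S"
  shows "dim {x\<in>S. f x = 0} + dim (f ` S) = dim S"
proof -
  let ?N = "{x\<in>S. f x = 0}"
  let ?N' = "{y\<in>S. \<forall>x\<in>?N. orthogonal x y}"
  have N: "subspace ?N" using S f
    by (auto simp: subspace_def linear_0 linear_add linear_scale)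
  have d: "dim ?N' + dim ?N = dim S"
    by (rule dim_subspace_orthogonal_to_vectors[OF N S]) auto
  have N': "subspace ?N'" using S by (auto simp: subspace_def orthogonal_clauses)
  have "inj_on f (span ?N')"
    unfolding span_eq_iff[THEN iffD2, OF N']
  proof (rule inj_onI)
    fix x y assume xy: "x \<in> ?N'" "y \<in> ?N'" "f x = f y"
    then have "x - y \<in> ?N" using S f by (simp add: subspace_diff linear_diff)
    moreover have "x - y \<in> ?N'" using N' xy by (intro subspace_diff)
    ultimately have "orthogonal (x - y) (x - y)" by blast
    then show "x = y" by (simp add: orthogonal_self)
  qed
  then have 1: "dim (f ` ?N') = dim ?N'" by (rule dim_image_eq[OF f])
  have "f ` S = f ` ?N'"
  proof
    show "f ` S \<subseteq> f ` ?N'"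
    proof
      fix z assume "z \<in> f ` S"
      then obtain x where x: "x \<in> S" "z = f x" by auto
      obtain y y' where y: "y \<in> span ?N" "\<And>w. w \<in> span ?N \<Longrightarrow> orthogonal y' w" "x = y + y'"
        using orthogonal_subspace_decomp_exists[of ?N x] by blast
      have y': "y \<in> ?N" using y(1) unfolding span_eq_iff[THEN iffD2, OF N] .
      have "y' = x - y" using y(3) by simp
      then have "y' \<in> S" using x y' S by (simp add: subspace_diff)
      moreover have "\<forall>x\<in>?N. orthogonal x y'" using y(2) by (auto simp: orthogonal_commute span_base)
      moreover have "f y' = z" using x y' f y(3) by (simp add: linear_add)
      ultimately show "z \<in> f ` ?N'" by auto
    qed
  qed auto
  then show ?thesis using d 1 by simp
qed

section \<open>Margins of vectors supported on an edge set\<close>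

definition coord_subspace :: "'e set \<Rightarrow> (real ^ 'e::finite) set" where
  "coord_subspace F = {x. \<forall>e. e \<notin> F \<longrightarrow> x $ e = 0}"

lemma subspace_coord_subspace: "subspace (coord_subspace F)"
  by (auto simp: subspace_def coord_subspace_def)

lemma dim_coord_subspace: "dim (coord_subspace F) = card F"
  unfolding coord_subspace_def using dim_substandard_cart[of F, where ?'a = real]
  by (simp add: dim_vec_eq)

text \<open>The incidence map of the bipartite graph: \<open>Inl i\<close> collects the inflow of
  \<open>i\<close>, \<open>Inr j\<close> the outflow of \<open>j\<close>. The sums run over all
  pairs, so one linear map serves every \<open>F\<close>; the support is imposed separately.\<close>

definition margins :: "real ^ ('n::finite \<times> 'n) \<Rightarrow> real ^ ('n + 'n)" where
  "margins x = (\<chi> v. case v of Inl i \<Rightarrow> \<Sum>j\<in>UNIV. x $ (j, i) | Inr j \<Rightarrow> \<Sum>i\<in>UNIV. x $ (j, i))"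

lemma margins_Inl: "margins x $ Inl i = (\<Sum>j\<in>UNIV. x $ (j, i))"
  and margins_Inr: "margins x $ Inr j = (\<Sum>i\<in>UNIV. x $ (j, i))"
  by (simp_all add: margins_def)

lemma vec_sum_eqI: "(\<And>i. x $ Inl i = y $ Inl i) \<Longrightarrow> (\<And>j. x $ Inr j = y $ Inr j) \<Longrightarrow> x = y"
  unfolding vec_eq_iff by (metis sum.exhaust)

lemma linear_margins: "linear margins"
  by (rule linearI; rule vec_sum_eqI)
     (simp_all add: margins_Inl margins_Inr sum.distrib sum_distrib_left)

lemma card_fibres_ge:
  assumes "finite D" "\<And>d. d \<in> D \<Longrightarrow> \<exists>d'\<in>D. d' \<noteq> d \<and> p d' = p d"
  shows "2 * card (p ` D) \<le> card D"
proof -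
  have "2 \<le> card {d\<in>D. p d = y}" if y: "y \<in> p ` D" for y
  proof -
    obtain d where d: "d \<in> D" "p d = y" using y by auto
    then obtain d' where d': "d' \<in> D" "d' \<noteq> d" "p d' = y" using assms(2) by metis
    have "card {d, d'} \<le> card {d\<in>D. p d = y}"
      using d d' assms(1) by (intro card_mono) auto
    then show ?thesis using d' by simp
  qed
  then have "(\<Sum>y\<in>p ` D. 2) \<le> (\<Sum>y\<in>p ` D. card {d\<in>D. p d = y})" by (intro sum_mono) auto
  also have "\<dots> = card D"
  proof -
    have "(\<Sum>y\<in>p ` D. card {d\<in>D. p d = y}) = (\<Sum>y\<in>p ` D. \<Sum>d\<in>{d\<in>D. p d = y}. 1)" by simp
    also have "\<dots> = card D" using sum.image_gen[OF assms(1), of "\<lambda>_. 1::nat" p] by simp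
    finally show ?thesis .
  qed
  finally show ?thesis by simp
qed

text \<open>
  A bipartite graph without leaves has at least as many edges as vertices, while the margins of
  vectors supported on it satisfy a linear relation.
\<close>

lemma ex_margins_kernel:
  fixes D :: "('n::finite \<times> 'n) set"
  assumes "D \<noteq> {}"
    and "\<And>j i. (j, i) \<in> D \<Longrightarrow> \<exists>j'. j' \<noteq> j \<and> (j', i) \<in> D"
    and "\<And>j i. (j, i) \<in> D \<Longrightarrow> \<exists>i'. i' \<noteq> i \<and> (j, i') \<in> D"
  shows "\<exists>u\<in>coord_subspace D. u \<noteq> 0 \<and> margins u = 0"
proof (rule ccontr)
  assume "\<not> ?thesis"
  then have "{x \<in> coord_subspace D. margins x = 0} \<subseteq> {0}" by auto
  then have "dim {x \<in> coord_subspace D. margins x = 0} = 0" unfolding dim_eq_0 .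
  then have d: "dim (margins ` coord_subspace D) = card D"
    using dim_kernel_image[OF linear_margins subspace_coord_subspace, of D] unfolding dim_coord_subspace by linarith
  define V where "V = Inl ` snd ` D \<union> Inr ` fst ` D"
  have "2 * card (snd ` D) \<le> card D"
    by (rule card_fibres_ge) (use assms(2) in \<open>auto, metis Pair_inject prod.sel(2)\<close>)
  moreover have "2 * card (fst ` D) \<le> card D"
    by (rule card_fibres_ge) (use assms(3) in \<open>auto, metis Pair_inject prod.sel(1)\<close>)
  moreover have "card V = card (snd ` D) + card (fst ` D)"
    unfolding V_def by (subst card_Un_disjoint) (auto simp: card_image)
  ultimately have cV: "card V \<le> card D" by simp
  have sub: "margins ` coord_subspace D \<subseteq> coord_subspace V"
  proof clarify
    fix x assume x: "x \<in> coord_subspace D"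
    have 1: "\<forall>i. i \<notin> snd ` D \<longrightarrow> margins x $ Inl i = 0"
      using x unfolding margins_Inl coord_subspace_def by (auto intro!: sum.neutral) force
    have 2: "\<forall>j. j \<notin> fst ` D \<longrightarrow> margins x $ Inr j = 0"
      using x unfolding margins_Inr coord_subspace_def by (auto intro!: sum.neutral) force
    have "margins x $ v = 0" if "v \<notin> V" for v
      using 1 2 that by (cases v) (auto simp: V_def inj_image_mem_iff)
    then show "margins x \<in> coord_subspace V" by (simp add: coord_subspace_def)
  qed
  have im: "subspace (margins ` coord_subspace D)"
    using linear_margins subspace_coord_subspace by (rule linear_subspace_image)
  \<comment> \<open>With a trivial kernel the margins would fill all of
    \<open>coord_subspace V\<close>. Then the unit vector at a left vertex would be a margin vector,
    with total 1 on the left and 0 on the right.\<close>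
  have eq: "margins ` coord_subspace D = coord_subspace V"
    by (rule subspace_dim_equal[OF im subspace_coord_subspace sub]) (simp add: d dim_coord_subspace cV)
  obtain j i where ji: "(j, i) \<in> D" using assms(1) by auto
  have "axis (Inl i) 1 \<in> coord_subspace V"
  proof -
    have "i \<in> snd ` D" using ji by force
    then show ?thesis by (auto simp: coord_subspace_def axis_def V_def)
  qed
  then obtain x where x: "margins x = axis (Inl i) 1" using eq by (metis imageE)
  have "(\<Sum>i'\<in>UNIV. margins x $ Inl i') = (\<Sum>j\<in>UNIV. margins x $ Inr j)"
    unfolding margins_Inl margins_Inr by (rule sum.swap)
  then show False unfolding x by (simp add: axis_def)
qed

lemma Ints_sum_one_fractional:
  fixes f :: "'a \<Rightarrow> real"
  assumes "finite A" "a \<in> A" "sum f A \<in> \<int>" "f a \<notin> \<int>"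
  shows "\<exists>b\<in>A. b \<noteq> a \<and> f b \<notin> \<int>"
proof (rule ccontr)
  assume "\<not> ?thesis"
  then have "sum f (A - {a}) \<in> \<int>" by (auto intro!: Ints_sum)
  then have "sum f A - sum f (A - {a}) \<in> \<int>" using assms by (intro Ints_diff)
  then show False using assms by (simp add: sum.remove[of A a])
qed

text \<open>Integral margins forbid a vertex with exactly one fractional edge, so the fractional
  edges carry a nonzero circulation \<open>u\<close>. Moving along \<open>u\<close> until some entry
  first becomes an integer keeps the margins and leaves fewer fractional entries.\<close>

lemma flow_rounding:
  fixes x :: "real ^ ('n::finite \<times> 'n)"
  assumes "margins x \<in> int_points"
  shows "\<exists>y\<in>int_points. margins y = margins x \<and> (\<forall>e. of_int \<lfloor>x $ e\<rfloor> \<le> y $ e \<and> y $ e \<le> of_int \<lceil>x $ e\<rceil>)"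
  using assms
proof (induction "card {e. x $ e \<notin> \<int>}" arbitrary: x rule: less_induct)
  case less
  define D where "D = {e. x $ e \<notin> \<int>}"
  show ?case
  proof (cases "D = {}")
    case True
    then have "x \<in> int_points" by (auto simp: D_def int_points_def)
    then show ?thesis by (intro bexI[of _ x]) auto
  next
    case False
    have "\<exists>u\<in>coord_subspace D. u \<noteq> 0 \<and> margins u = 0"
    proof (rule ex_margins_kernel[OF False])
      fix j i assume ji: "(j, i) \<in> D"
      have "(\<Sum>j\<in>UNIV. x $ (j, i)) \<in> \<int>" "(\<Sum>i\<in>UNIV. x $ (j, i)) \<in> \<int>"
        using less.prems unfolding int_points_def by (auto simp flip: margins_Inl margins_Inr)
      then show "\<exists>j'. j' \<noteq> j \<and> (j', i) \<in> D" "\<exists>i'. i' \<noteq> i \<and> (j, i') \<in> D"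
        using Ints_sum_one_fractional[of UNIV j "\<lambda>j. x $ (j, i)"]
          Ints_sum_one_fractional[of UNIV i "\<lambda>i. x $ (j, i)"] ji by (auto simp: D_def)
    qed
    then obtain u where u: "u \<in> coord_subspace D" "u \<noteq> 0" "margins u = 0" by blast
    \<comment> \<open>The distance along \<open>u\<close> after which the entry \<open>e\<close>
      reaches its ceiling or floor. Where \<open>u $ e = 0\<close>, division by zero gives 0, which
      is harmless since the minimum is taken over \<open>E\<close>.\<close>
    define r where "r = (\<lambda>e. if u $ e > 0 then (of_int \<lceil>x $ e\<rceil> - x $ e) / u $ e
      else (x $ e - of_int \<lfloor>x $ e\<rfloor>) / - u $ e)"
    define E where "E = {e. u $ e \<noteq> 0}"
    have E: "finite E" "E \<noteq> {}" using u(2) by (auto simp: E_def vec_eq_iff)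
    have ED: "E \<subseteq> D" using u(1) by (auto simp: E_def coord_subspace_def)
    obtain e0 where e0: "e0 \<in> E" "\<And>e. e \<in> E \<Longrightarrow> r e0 \<le> r e"
      using arg_min_if_finite(1)[OF E, of r] arg_min_least[OF E, of _ r] by blast
    define x' where "x' = x + r e0 *\<^sub>R u"
    have r0: "r e \<ge> 0" for e unfolding r_def by (auto simp: divide_nonneg_nonneg divide_nonneg_nonpos le_of_int_ceiling)
    have bounds: "of_int \<lfloor>x $ e\<rfloor> \<le> x' $ e \<and> x' $ e \<le> of_int \<lceil>x $ e\<rceil>" for e
    proof (cases "u $ e" "0 :: real" rule: linorder_cases)
      case less
      then have "r e0 \<le> (x $ e - of_int \<lfloor>x $ e\<rfloor>) / - u $ e" using e0(2)[of e] by (simp add: E_def r_def)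
      then have "r e0 * - u $ e \<le> x $ e - of_int \<lfloor>x $ e\<rfloor>" using less by (subst (asm) pos_le_divide_eq) auto
      moreover have "r e0 * u $ e \<le> 0" using r0[of e0] less by (simp add: mult_nonneg_nonpos)
      ultimately show ?thesis by (simp add: x'_def) linarith
    next
      case equal
      then show ?thesis by (simp add: x'_def)
    next
      case greater
      then have "r e0 \<le> (of_int \<lceil>x $ e\<rceil> - x $ e) / u $ e" using e0(2)[of e] by (simp add: E_def r_def)
      then have "r e0 * u $ e \<le> of_int \<lceil>x $ e\<rceil> - x $ e" using greater by (simp add: pos_le_divide_eq)
      moreover have "r e0 * u $ e \<ge> 0" using r0[of e0] greater by simp
      ultimately show ?thesis by (simp add: x'_def) linarith
    qed
    have x'0: "x' $ e0 \<in> \<int>"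
      using e0(1) by (auto simp: x'_def r_def E_def)
    have "x' $ e \<in> \<int>" if "x $ e \<in> \<int>" for e
    proof -
      have "e \<notin> E" using that ED by (auto simp: D_def)
      then show ?thesis using that by (simp add: x'_def E_def)
    qed
    then have "{e. x' $ e \<notin> \<int>} \<subset> {e. x $ e \<notin> \<int>}" using x'0 e0(1) ED by (auto simp: D_def)
    then have "card {e. x' $ e \<notin> \<int>} < card {e. x $ e \<notin> \<int>}" by (intro psubset_card_mono) auto
    moreover have mx: "margins x' = margins x"
      using u(3) by (simp add: x'_def linear_add[OF linear_margins] linear_scale[OF linear_margins])
    ultimately obtain y where y: "y \<in> int_points" "margins y = margins x"
      "\<forall>e. of_int \<lfloor>x' $ e\<rfloor> \<le> y $ e \<and> y $ e \<le> of_int \<lceil>x' $ e\<rceil>"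
      using less.hyps[of x'] less.prems by auto
    have "of_int \<lfloor>x $ e\<rfloor> \<le> y $ e \<and> y $ e \<le> of_int \<lceil>x $ e\<rceil>" for e
    proof -
      have "\<lfloor>x $ e\<rfloor> \<le> \<lfloor>x' $ e\<rfloor>" "\<lceil>x' $ e\<rceil> \<le> \<lceil>x $ e\<rceil>"
        using bounds[of e] by (auto simp: le_floor_iff ceiling_le_iff)
      then show ?thesis using y(3)[rule_format, of e] by (meson of_int_le_iff order_trans)
    qed
    then show ?thesis using y by blast
  qed
qed

subsection \<open>Circulations: lattice bases and dimension\<close>

text \<open>\<open>U\<close> is the complement of a largest \<open>T\<close> such that no nonzero
  vector of \<open>K\<close> is supported on \<open>T\<close>. Enlarging \<open>T\<close> by
  \<open>u\<close> admits such a vector; it is nonzero at \<open>u\<close>, and scaling it gives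
  \<open>X u\<close>.\<close>

lemma ex_dual_coordinates:
  fixes K :: "(real ^ 'd::finite) set"
  assumes K: "subspace K"
  shows "\<exists>U X. (\<forall>u\<in>U. X u \<in> K \<and> (\<forall>u'\<in>U. X u $ u' = (if u' = u then 1 else 0))) \<and>
    (\<forall>x\<in>K. (\<forall>u\<in>U. x $ u = 0) \<longrightarrow> x = 0)"
proof -
  let ?P = "\<lambda>T. K \<inter> coord_subspace T \<subseteq> {0}"
  have "?P {}" by (auto simp: coord_subspace_def vec_eq_iff)
  moreover have "\<forall>T. ?P T \<longrightarrow> card T < Suc CARD('d)" by (auto simp: less_Suc_eq_le intro: card_mono)
  ultimately obtain T where T: "?P T" "\<And>T'. ?P T' \<Longrightarrow> card T' \<le> card T"
    using ex_has_greatest_nat[of ?P "{}" card "Suc CARD('d)"] by blast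
  have "\<exists>x\<in>K. \<forall>u'\<in>- T. x $ u' = (if u' = u then 1 else 0)" if u: "u \<in> - T" for u
  proof -
    have "card T < card (insert u T)" using u by simp
    then have "\<not> ?P (insert u T)" using T(2)[of "insert u T"] by linarith
    then obtain x where x: "x \<in> K" "x \<in> coord_subspace (insert u T)" "x \<noteq> 0" by auto
    then have "x $ u \<noteq> 0" using T(1) by (auto simp: coord_subspace_def)
    then show ?thesis using x K
      by (intro bexI[of _ "(1 / x $ u) *\<^sub>R x"]) (auto simp: coord_subspace_def subspace_scale)
  qed
  then obtain X where "\<forall>u\<in>- T. X u \<in> K \<and> (\<forall>u'\<in>- T. X u $ u' = (if u' = u then 1 else 0))"
    by metis
  moreover have "\<forall>x\<in>K. (\<forall>u\<in>- T. x $ u = 0) \<longrightarrow> x = 0"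
    using T(1) by (auto simp: coord_subspace_def)
  ultimately show ?thesis by blast
qed

definition circulations :: "('n::finite \<times> 'n) set \<Rightarrow> (real ^ ('n \<times> 'n)) set" where
  "circulations F = {x \<in> coord_subspace F. margins x = 0}"

lemma subspace_circulations: "subspace (circulations F)"
  unfolding circulations_def subspace_def using subspace_coord_subspace[of F]
  by (auto simp: linear_add[OF linear_margins] linear_scale[OF linear_margins] linear_0[OF linear_margins]
      subspace_def)

lemma flow_rounding_supported:
  fixes x :: "real ^ ('n::finite \<times> 'n)"
  assumes "margins x \<in> int_points" "x \<in> coord_subspace F"
  shows "\<exists>y\<in>int_points \<inter> coord_subspace F. margins y = margins x \<and>
    (\<forall>e. of_int \<lfloor>x $ e\<rfloor> \<le> y $ e \<and> y $ e \<le> of_int \<lceil>x $ e\<rceil>)"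
proof -
  obtain y where y: "y\<in>int_points" "margins y = margins x"
    "\<And>e. of_int \<lfloor>x $ e\<rfloor> \<le> y $ e \<and> y $ e \<le> of_int \<lceil>x $ e\<rceil>"
    using flow_rounding[OF assms(1)] by blast
  have "y $ e = 0" if "e \<notin> F" for e
  proof -
    have "x $ e = 0" using assms(2) that unfolding coord_subspace_def by blast
    then show ?thesis using y(3)[of e] by simp
  qed
  then have "y \<in> coord_subspace F" by (simp add: coord_subspace_def)
  then show ?thesis using y by blast
qed

text \<open>
  By uniqueness, the dual coordinate vectors coincide with their roundings, so they are integral.
\<close>

lemma circulations_lattice_basis:
  fixes F :: "('n::finite \<times> 'n) set"
  shows "\<exists>B. lattice_basis (int_points \<inter> circulations F) B \<and> circulations F \<subseteq> span B"
proof -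
  let ?K = "circulations F"
  obtain U X where X: "\<And>u. u \<in> U \<Longrightarrow> X u \<in> ?K"
      "\<And>u u'. u \<in> U \<Longrightarrow> u' \<in> U \<Longrightarrow> X u $ u' = (if u' = u then 1 else 0)"
    and uniq: "\<And>x. x \<in> ?K \<Longrightarrow> \<forall>u\<in>U. x $ u = 0 \<Longrightarrow> x = 0"
    using ex_dual_coordinates[OF subspace_circulations[of F]] by metis
  have int: "X u \<in> int_points" if u: "u \<in> U" for u
  proof -
    have Xu: "X u \<in> coord_subspace F" "margins (X u) = 0" using X(1)[OF u] by (auto simp: circulations_def)
    then obtain y where y: "y \<in> int_points" "y \<in> coord_subspace F" "margins y = 0"
      "\<And>e. of_int \<lfloor>X u $ e\<rfloor> \<le> y $ e \<and> y $ e \<le> of_int \<lceil>X u $ e\<rceil>"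
      using flow_rounding_supported[of "X u" F] by (auto simp: int_points_def)
    have "y $ u' = X u $ u'" if "u' \<in> U" for u'
      using y(4)[of u'] X(2)[OF u that] by (auto split: if_splits)
    moreover have "y - X u \<in> ?K"
      using y X(1)[OF u] by (intro subspace_diff subspace_circulations) (auto simp: circulations_def)
    ultimately have "y - X u = 0" by (intro uniq) auto
    then show ?thesis using y(1) by simp
  qed
  have coord: "(\<Sum>u\<in>U. c u *\<^sub>R X u) $ u' = c u'" if "u' \<in> U" for c u'
  proof -
    have "(\<Sum>u\<in>U. c u *\<^sub>R X u) $ u' = (\<Sum>u\<in>U. if u = u' then c u' else 0)"
      unfolding sum_component by (intro sum.cong refl) (use X(2) that in auto)
    then show ?thesis using that by simp
  qed
  have comb: "x = (\<Sum>u\<in>U. (x $ u) *\<^sub>R X u)" if x: "x \<in> ?K" for x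
  proof -
    have "x - (\<Sum>u\<in>U. (x $ u) *\<^sub>R X u) \<in> ?K"
      using x X(1) by (intro subspace_diff subspace_sum subspace_scale subspace_circulations) auto
    moreover have "(x - (\<Sum>u\<in>U. (x $ u) *\<^sub>R X u)) $ u' = 0" if "u' \<in> U" for u'
      using coord[OF that, of "\<lambda>u. x $ u"] by simp
    ultimately have "x - (\<Sum>u\<in>U. (x $ u) *\<^sub>R X u) = 0" using uniq by blast
    then show ?thesis by simp
  qed
  have inj: "inj_on X U"
    by (rule inj_onI) (metis X(2) zero_neq_one)
  have val: "(\<Sum>b\<in>X ` U. c b *\<^sub>R b) $ u = c (X u)" if "u \<in> U" for c u
    using coord[OF that, of "\<lambda>u. c (X u)"] by (simp add: sum.reindex[OF inj])
  have "independent (X ` U)"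
  proof (rule independent_if_scalars_zero)
    fix f x assume "(\<Sum>b\<in>X ` U. f b *\<^sub>R b) = 0" "x \<in> X ` U"
    then show "f x = 0" using val[of _ f] by auto
  qed auto
  moreover have "int_points \<inter> ?K = {\<Sum>b\<in>X ` U. of_int (c b) *\<^sub>R b | c. True}"
  proof (intro equalityI subsetI)
    fix x assume x: "x \<in> int_points \<inter> ?K"
    have "x $ u \<in> \<int>" for u using x unfolding int_points_def by blast
    then have fl: "of_int \<lfloor>x $ u\<rfloor> = x $ u" for u by (metis Ints_cases floor_of_int)
    define c where "c = (\<lambda>b. \<lfloor>x $ inv_into U X b\<rfloor>)"
    have "(\<Sum>b\<in>X ` U. of_int (c b) *\<^sub>R b) = (\<Sum>u\<in>U. (x $ u) *\<^sub>R X u)"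
      unfolding sum.reindex[OF inj] o_def c_def
      by (intro sum.cong refl) (simp add: inj fl)
    then have "x = (\<Sum>b\<in>X ` U. of_int (c b) *\<^sub>R b)" using comb x by auto
    then show "x \<in> {\<Sum>b\<in>X ` U. of_int (c b) *\<^sub>R b | c. True}" by blast
  next
    fix x assume "x \<in> {\<Sum>b\<in>X ` U. real_of_int (c b) *\<^sub>R b | c. True}"
    then obtain c where c: "x = (\<Sum>b\<in>X ` U. real_of_int (c b) *\<^sub>R b)" by blast
    have "x \<in> ?K" unfolding c using X(1)
      by (intro subspace_sum subspace_scale subspace_circulations) auto
    moreover have "x \<in> int_points" using int unfolding c int_points_def by (auto intro!: Ints_sum)
    ultimately show "x \<in> int_points \<inter> ?K" by blast
  qed
  moreover have "?K \<subseteq> span (X ` U)"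
  proof
    fix x assume "x \<in> ?K"
    from comb[OF this] show "x \<in> span (X ` U)"
      by (metis (no_types, lifting) imageI span_base span_scale span_sum)
  qed
  ultimately show ?thesis unfolding lattice_basis_def by blast
qed

lemma lattice_basis_subset:
  assumes "lattice_basis \<Lambda> B"
  shows "B \<subseteq> \<Lambda>"
proof
  fix b assume b: "b \<in> B"
  have "finite B" using assms by (simp add: lattice_basis_def independent_imp_finite)
  moreover have "(\<Sum>b'\<in>B. of_int (if b' = b then 1 else 0) *\<^sub>R b') = (\<Sum>b'\<in>B. if b' = b then b else 0)"
    by (intro sum.cong) auto
  ultimately have "b = (\<Sum>b'\<in>B. of_int (if b' = b then 1 else 0) *\<^sub>R b')"
    using b by simp
  then have "\<exists>c. b = (\<Sum>b'\<in>B. real_of_int (c b') *\<^sub>R b')" by (rule exI[of _ "\<lambda>b'. if b' = b then 1 else 0"])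
  then show "b \<in> \<Lambda>" using assms unfolding lattice_basis_def by simp
qed

text \<open>The volume is defined by an arbitrarily chosen lattice basis. Every such
  \<open>B\<close> generates, over the integers, one basis that is known to span, so
  \<open>B\<close> spans as well.\<close>

lemma circulations_lattice_basis_unique:
  assumes "lattice_basis (int_points \<inter> circulations F) B"
  shows "span B = circulations F" "card B = dim (circulations F)"
proof -
  obtain B' where B': "lattice_basis (int_points \<inter> circulations F) B'" "circulations F \<subseteq> span B'"
    using circulations_lattice_basis by blast
  have "B' \<subseteq> span B"
  proof
    fix b assume "b \<in> B'"
    then have "b \<in> int_points \<inter> circulations F" using lattice_basis_subset[OF B'(1)] by blast
    then obtain c where "b = (\<Sum>b\<in>B. real_of_int (c b) *\<^sub>R b)" using assms unfolding lattice_basis_def by auto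
    then show "b \<in> span B" by (metis (no_types, lifting) span_base span_scale span_sum)
  qed
  then have "circulations F \<subseteq> span B" using B'(2) span_minimal[of B' "span B"] by auto
  moreover have sub: "B \<subseteq> circulations F" using lattice_basis_subset[OF assms] by blast
  ultimately show "span B = circulations F"
    using span_minimal[OF _ subspace_circulations] by blast
  have "independent B" using assms by (simp add: lattice_basis_def)
  then show "card B = dim (circulations F)"
    using sub \<open>circulations F \<subseteq> span B\<close> by (simp add: basis_card_eq_dim)
qed

section \<open>The dimension of the circulations from the components of the bipartite graph\<close>

lemma dim_signed_class_functions:
  fixes s :: "'v::finite \<Rightarrow> real"
  assumes r: "equiv UNIV r" and s: "\<And>v. s v * s v = 1"
  shows "dim {y :: real ^ 'v. \<forall>(a, b)\<in>r. y $ a * s a = y $ b * s b} = card (UNIV // r)"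
proof -
  let ?V = "{y :: real ^ 'v. \<forall>(a, b)\<in>r. y $ a * s a = y $ b * s b}"
  \<comment> \<open>Signed indicator vectors of the classes. Distinct classes are disjoint, so these
    vectors are orthogonal and hence independent.\<close>
  define ind :: "'v set \<Rightarrow> real ^ 'v" where "ind = (\<lambda>X. \<chi> v. if v \<in> X then s v else 0)"
  have s0: "s v \<noteq> 0" for v using s[of v] by auto
  have disj: "X = Y" if "X \<in> UNIV // r" "Y \<in> UNIV // r" "v \<in> X" "v \<in> Y" for X Y v
    using quotient_disj[OF r that(1,2)] that(3,4) by blast
  have ne: "X \<noteq> {}" if "X \<in> UNIV // r" for X
    using in_quotient_imp_non_empty[OF r that] .
  have inj: "inj_on ind (UNIV // r)"
  proof (rule inj_onI)
    fix X Y assume "X \<in> UNIV // r" "Y \<in> UNIV // r" and eq: "ind X = ind Y"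
    have "v \<in> X \<longleftrightarrow> v \<in> Y" for v
      using arg_cong[OF eq, of "\<lambda>y. y $ v"] s0[of v] by (auto simp: ind_def split: if_splits)
    then show "X = Y" by blast
  qed
  show ?thesis
  proof (rule dim_unique)
    show "ind ` (UNIV // r) \<subseteq> ?V"
    proof clarify
      fix X a b assume X: "X \<in> UNIV // r" and ab: "(a, b) \<in> r"
      have "a \<in> X \<longleftrightarrow> b \<in> X"
        using X ab r by (meson in_quotient_imp_closed equivE symE)
      then show "ind X $ a * s a = ind X $ b * s b" by (simp add: ind_def s)
    qed
    show "independent (ind ` (UNIV // r))"
    proof (rule pairwise_orthogonal_independent)
      show "pairwise orthogonal (ind ` (UNIV // r))"
      proof (clarsimp simp: pairwise_def)
        fix X Y assume XY: "X \<in> UNIV // r" "Y \<in> UNIV // r" "ind X \<noteq> ind Y"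
        then have "X \<inter> Y = {}" using disj by blast
        then show "orthogonal (ind X) (ind Y)"
          unfolding orthogonal_def inner_vec_def ind_def by (auto intro!: sum.neutral)
      qed
      show "0 \<notin> ind ` (UNIV // r)"
      proof
        assume "0 \<in> ind ` (UNIV // r)"
        then obtain X where X: "X \<in> UNIV // r" "ind X = 0" by auto
        obtain v where "v \<in> X" using ne[OF X(1)] by auto
        then show False using arg_cong[OF X(2), of "\<lambda>y. y $ v"] s0[of v] by (simp add: ind_def)
      qed
    qed
    show "card (ind ` (UNIV // r)) = card (UNIV // r)" by (rule card_image[OF inj])
    show "?V \<subseteq> span (ind ` (UNIV // r))"
    proof
      fix y assume y: "y \<in> ?V"
      define c where "c = (\<lambda>X. let a = SOME a. a \<in> X in y $ a * s a)"
      have "y $ v = (\<Sum>X\<in>UNIV // r. c X *\<^sub>R ind X) $ v" for v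
      proof -
        let ?X = "r `` {v}"
        have X: "?X \<in> UNIV // r" by (simp add: quotientI)
        have v: "v \<in> ?X" using equiv_class_self[OF r UNIV_I] .
        then have "(SOME a. a \<in> ?X) \<in> ?X" by (rule someI)
        then have "(v, SOME a. a \<in> ?X) \<in> r" by simp
        then have "c ?X = y $ v * s v" using y unfolding c_def Let_def by force
        have "(\<Sum>X\<in>UNIV // r. c X *\<^sub>R ind X) $ v = (\<Sum>X\<in>UNIV // r. c X * ind X $ v)" by simp
        also have "\<dots> = (\<Sum>X\<in>UNIV // r. if X = ?X then c ?X * s v else 0)"
        proof (rule sum.cong[OF refl])
          fix Y assume Y: "Y \<in> UNIV // r"
          have "v \<in> Y \<longleftrightarrow> Y = ?X" using disj[OF Y X _ v] v by blast
          then show "c Y * ind Y $ v = (if Y = ?X then c ?X * s v else 0)" by (auto simp: ind_def)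
        qed
        also have "\<dots> = c ?X * s v" using X by simp
        also have "\<dots> = y $ v" using \<open>c ?X = _\<close> s[of v] by simp
        finally show ?thesis by simp
      qed
      then have "y = (\<Sum>X\<in>UNIV // r. c X *\<^sub>R ind X)" by (simp add: vec_eq_iff)
      then show "y \<in> span (ind ` (UNIV // r))"
        by (metis (no_types, lifting) imageI span_base span_scale span_sum)
    qed
  qed
qed

lemma margins_inner:
  "margins x \<bullet> y = (\<Sum>j\<in>UNIV. \<Sum>i\<in>UNIV. x $ (j, i) * (y $ Inl i + y $ Inr j))"
proof -
  have "margins x \<bullet> y = (\<Sum>i\<in>UNIV. margins x $ Inl i * y $ Inl i) + (\<Sum>j\<in>UNIV. margins x $ Inr j * y $ Inr j)"
    unfolding inner_vec_def UNIV_Plus_UNIV[symmetric] by (subst sum.Plus) auto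
  also have "(\<Sum>i\<in>UNIV. margins x $ Inl i * y $ Inl i) = (\<Sum>j\<in>UNIV. \<Sum>i\<in>UNIV. x $ (j, i) * y $ Inl i)"
    unfolding margins_Inl sum_distrib_right by (rule sum.swap)
  finally show ?thesis
    unfolding margins_Inr by (simp add: sum_distrib_right distrib_left sum.distrib)
qed

text \<open>A vector \<open>y\<close> is orthogonal to all margins iff
  \<open>y $ Inl i + y $ Inr j = 0\<close> along every edge. After a sign change on the right side
  this means being constant on components, so the rank of \<open>margins\<close> on \<open>F\<close>
  is \<open>2 * N\<close> minus the number of components; rank-nullity then gives
  \<open>q_dim F\<close>.\<close>

lemma dim_circulations: "int (dim (circulations F)) = q_dim F"
proof -
  let ?W = "margins ` coord_subspace F"
  define s :: "'a + 'a \<Rightarrow> real" where "s = (\<lambda>v. case v of Inl _ \<Rightarrow> 1 | Inr _ \<Rightarrow> -1)"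
  define E where "E = bip_edges F \<union> (bip_edges F)\<inverse>"
  have r: "equiv UNIV (E\<^sup>*)"
    by (intro equivI refl_rtrancl trans_rtrancl sym_rtrancl) (auto simp: E_def sym_Un_converse refl_rtrancl)
  have "{y\<in>UNIV. \<forall>x\<in>?W. orthogonal x y} = {y. \<forall>(a, b)\<in>E\<^sup>*. y $ a * s a = y $ b * s b}"
  proof (intro equalityI subsetI)
    fix y assume y: "y \<in> {y\<in>UNIV. \<forall>x\<in>?W. orthogonal x y}"
    have edge: "y $ Inl i + y $ Inr j = 0" if "(j, i) \<in> F" for j i
    proof -
      have "axis (j, i) 1 \<in> coord_subspace F" using that by (auto simp: coord_subspace_def axis_def)
      then have "margins (axis (j, i) 1) \<bullet> y = 0" using y by (auto simp: orthogonal_def)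
      moreover have "margins (axis (j, i) 1) \<bullet> y = (\<Sum>j'\<in>UNIV. \<Sum>i'\<in>UNIV.
          if j' = j then (if i' = i then y $ Inl i' + y $ Inr j' else 0) else 0)"
        unfolding margins_inner by (intro sum.cong refl) (auto simp: axis_def)
      moreover have "(\<Sum>i'\<in>UNIV. if j' = j then (if i' = i then y $ Inl i' + y $ Inr j' else 0) else 0)
          = (if j' = j then y $ Inl i + y $ Inr j' else 0)" for j'
        by simp
      ultimately show ?thesis by simp
    qed
    have step: "y $ a * s a = y $ b * s b" if "(a, b) \<in> E" for a b
      using that edge unfolding E_def bip_edges_def s_def by (auto, (smt (verit))+)
    have "y $ a * s a = y $ b * s b" if "(a, b) \<in> E\<^sup>*" for a b
      using that by (induction rule: rtrancl_induct) (auto dest: step)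
    then show "y \<in> {y. \<forall>(a, b)\<in>E\<^sup>*. y $ a * s a = y $ b * s b}" by auto
  next
    fix y assume y: "y \<in> {y. \<forall>(a, b)\<in>E\<^sup>*. y $ a * s a = y $ b * s b}"
    have edge: "y $ Inl i + y $ Inr j = 0" if "(j, i) \<in> F" for j i
    proof -
      have "(Inl i, Inr j) \<in> E" using that by (auto simp: E_def bip_edges_def)
      then have "y $ Inl i * s (Inl i) = y $ Inr j * s (Inr j)" using y by blast
      then show ?thesis by (simp add: s_def)
    qed
    have "margins x \<bullet> y = 0" if "x \<in> coord_subspace F" for x
      unfolding margins_inner using that edge by (intro sum.neutral ballI) (fastforce simp: coord_subspace_def)
    then show "y \<in> {y\<in>UNIV. \<forall>x\<in>?W. orthogonal x y}" by (auto simp: orthogonal_def)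
  qed
  moreover have "dim {y :: real ^ ('a + 'a). \<forall>(a, b)\<in>E\<^sup>*. y $ a * s a = y $ b * s b} = num_components F"
    unfolding num_components_def E_def[symmetric]
    by (rule dim_signed_class_functions[OF r]) (simp add: s_def split: sum.split)
  moreover have "dim {y\<in>UNIV. \<forall>x\<in>?W. orthogonal x y} + dim ?W = dim (UNIV :: (real ^ ('a + 'a)) set)"
    using linear_subspace_image[OF linear_margins subspace_coord_subspace]
    by (intro dim_subspace_orthogonal_to_vectors) auto
  moreover have "dim (circulations F) + dim ?W = card F"
    using dim_kernel_image[OF linear_margins subspace_coord_subspace, of F]
    unfolding dim_coord_subspace circulations_def .
  ultimately show ?thesis unfolding q_dim_def by (simp add: dim_UNIV)
qed

subsection \<open>Cones over flows in unit boxes\<close>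

lemma int_points_nth: "x \<in> int_points \<Longrightarrow> x $ e \<in> \<int>"
  by (simp add: int_points_def)

lemma int_vecs_vec: "(int_vecs :: (real ^ 'd::finite) set) = int_points"
  unfolding int_vecs_def int_points_def Basis_vec_def by (auto simp: inner_axis)

lemma int_vecs_Pair: "(x, m) \<in> int_vecs \<longleftrightarrow> x \<in> int_vecs \<and> (m :: real) \<in> \<int>"
  unfolding int_vecs_def Basis_prod_def by auto

lemma int_vecs_uminus: "x \<in> int_vecs \<Longrightarrow> - x \<in> int_vecs"
  using int_vecs_scaleR[of "-1" x] by simp

lemma axis_int_vecs: "axis e (1 :: real) \<in> int_vecs"
  by (rule subsetD[OF Basis_subset_int_vecs]) simp

definition demand :: "('n::finite \<Rightarrow> nat) \<Rightarrow> real ^ ('n + 'n)" where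
  "demand k = (\<chi> v. real (case v of Inl i \<Rightarrow> k i | Inr j \<Rightarrow> k j))"

lemma demand_int_points: "demand k \<in> int_points"
  unfolding demand_def int_points_def by (intro CollectI allI) (simp only: vec_lambda_beta Ints_of_nat)

text \<open>A linear subspace, so the height \<open>m\<close> may be negative here; the inequalities
  that cut out a cone are kept apart in the constraint sets.\<close>

definition flow_cone :: "('n::finite \<times> 'n) set \<Rightarrow> ('n \<Rightarrow> nat) \<Rightarrow> ((real ^ ('n \<times> 'n)) \<times> real) set" where
  "flow_cone F k = {(x, m). x \<in> coord_subspace F \<and> margins x = m *\<^sub>R demand k}"

lemma subspace_flow_cone: "subspace (flow_cone F k)"
proof (rule subspaceI)
  show "0 \<in> flow_cone F k"
    by (simp add: flow_cone_def zero_prod_def subspace_0[OF subspace_coord_subspace] linear_0[OF linear_margins])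
next
  fix x y assume "x \<in> flow_cone F k" "y \<in> flow_cone F k"
  then show "x + y \<in> flow_cone F k"
    by (cases x, cases y) (simp add: flow_cone_def subspace_add[OF subspace_coord_subspace]
        linear_add[OF linear_margins] scaleR_add_left)
next
  fix c x assume "x \<in> flow_cone F k"
  then show "c *\<^sub>R x \<in> flow_cone F k"
    by (cases x) (simp add: flow_cone_def subspace_scale[OF subspace_coord_subspace] linear_scale[OF linear_margins])
qed

lemma dim_flow_cone:
  assumes "(a, 1) \<in> flow_cone F k"
  shows "dim (flow_cone F k) = Suc (dim (circulations F))"
proof -
  have "Suc (dim {x \<in> flow_cone F k. (0, 1) \<bullet> x = 0}) = dim (flow_cone F k)"
    by (rule dim_hyperplane_section[OF subspace_flow_cone assms]) simp
  moreover have "{x \<in> flow_cone F k. (0, 1) \<bullet> x = 0} = (\<lambda>x. (x, 0)) ` circulations F"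
    by (auto simp: flow_cone_def circulations_def)
  moreover have "dim ((\<lambda>x. (x, 0 :: real)) ` circulations F) = dim (circulations F)"
    by (rule dim_image_eq) (auto intro!: linearI inj_onI)
  ultimately show ?thesis by simp
qed

text \<open>The constraints \<open>l e * m \<le> x e \<le> (l e + 1) * m\<close> on \<open>(x, m)\<close>.\<close>

definition box_constraints :: "'e set \<Rightarrow> ('e \<Rightarrow> nat) \<Rightarrow> ((real ^ 'e::finite) \<times> real) set" where
  "box_constraints F l = (\<lambda>e. (axis e 1, - real (l e))) ` F \<union> (\<lambda>e. (- axis e 1, real (l e) + 1)) ` F"

text \<open>Stated for a predicate on the values at two points, so that one expansion covers
  nonnegativity, the lexicographic sign and the condition on faces.\<close>

lemma box_constraints_ball:
  "(\<forall>\<phi>\<in>box_constraints F l. P (\<phi> \<bullet> (x, m)) (\<phi> \<bullet> (y, n))) \<longleftrightarrow>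
    (\<forall>e\<in>F. P (x $ e - real (l e) * m) (y $ e - real (l e) * n) \<and>
      P ((real (l e) + 1) * m - x $ e) ((real (l e) + 1) * n - y $ e))"
  unfolding box_constraints_def ball_Un ball_simps by (auto simp: inner_axis')

lemma finite_bounded_int_points:
  "finite {x :: real ^ 'd::finite. x \<in> int_points \<and> (\<forall>e. 0 \<le> x $ e \<and> x $ e \<le> c)}"
proof -
  let ?A = "of_int ` {0..\<lfloor>c\<rfloor>} :: real set"
  have "{x :: real ^ 'd. x \<in> int_points \<and> (\<forall>e. 0 \<le> x $ e \<and> x $ e \<le> c)} \<subseteq> vec_lambda ` (UNIV \<rightarrow>\<^sub>E ?A)"
  proof clarify
    fix x :: "real ^ 'd" assume x: "x \<in> int_points" "\<forall>e. 0 \<le> x $ e \<and> x $ e \<le> c"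
    have "x $ e \<in> ?A" for e
    proof -
      obtain z where "x $ e = of_int z" using Ints_cases[OF int_points_nth[OF x(1), of e]] by blast
      then show ?thesis using x(2)[rule_format, of e] by (auto simp: le_floor_iff)
    qed
    then have "($) x \<in> UNIV \<rightarrow>\<^sub>E ?A" by auto
    then show "x \<in> vec_lambda ` (UNIV \<rightarrow>\<^sub>E ?A)" by (metis imageI vec_nth_inverse)
  qed
  then show ?thesis by (rule finite_subset) (intro finite_imageI finite_PiE; simp)
qed

text \<open>Round \<open>x\<close> divided by its height. Box walls are integral, so rounding stays
  in the box and does not move an entry that lies on a wall; the rounded flow therefore lies on
  every face that contains \<open>x\<close>.\<close>

lemma compressed_flow_box:
  fixes F :: "('n::finite \<times> 'n) set"
  assumes "F \<noteq> {}"
  shows "compressed_cone (0, 1) (box_constraints F l) (flow_cone F k)"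
proof -
  let ?\<Phi> = "box_constraints F l" and ?S = "flow_cone F k"
  have ball: "(\<forall>\<phi>\<in>?\<Phi>. 0 \<le> \<phi> \<bullet> (x, m)) \<longleftrightarrow> (\<forall>e\<in>F. real (l e) * m \<le> x $ e \<and> x $ e \<le> (real (l e) + 1) * m)"
    for x m using box_constraints_ball[of F l "\<lambda>a b. 0 \<le> a" x m x m] by simp
  have pos: "m > 0" if x: "(x, m) \<in> ?S" "\<forall>\<phi>\<in>?\<Phi>. 0 \<le> \<phi> \<bullet> (x, m)" "(x, m) \<noteq> 0" for x m
  proof (rule ccontr)
    assume "\<not> m > 0"
    have b: "\<And>e. e \<in> F \<Longrightarrow> real (l e) * m \<le> x $ e" "\<And>e. e \<in> F \<Longrightarrow> x $ e \<le> (real (l e) + 1) * m"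
      using x(2) unfolding ball by auto
    \<comment> \<open>The two opposite walls of a single edge already force
      \<open>m \<ge> 0\<close>; at height 0 all walls collapse to \<open>x $ e = 0\<close>.\<close>
    obtain e where "e \<in> F" using assms by auto
    then have "real (l e) * m \<le> (real (l e) + 1) * m" using b[of e] by linarith
    then have "m = 0" using \<open>\<not> m > 0\<close> by (simp add: algebra_simps)
    have "x $ e = 0" for e
    proof (cases "e \<in> F")
      case True
      then show ?thesis using b[of e] \<open>m = 0\<close> by simp
    next
      case False
      then show ?thesis using x(1) unfolding flow_cone_def coord_subspace_def by blast
    qed
    then show False using \<open>m = 0\<close> x(3) by (simp add: vec_eq_iff zero_prod_def)
  qed
  have fin: "finite {x \<in> ?S \<inter> int_vecs. (\<forall>\<phi>\<in>?\<Phi>. 0 \<le> \<phi> \<bullet> x) \<and> (0, 1) \<bullet> x = real m}" for m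
  proof -
    define c where "c = (\<Sum>e\<in>UNIV. real (l e) + 1) * real m"
    have "{x \<in> ?S \<inter> int_vecs. (\<forall>\<phi>\<in>?\<Phi>. 0 \<le> \<phi> \<bullet> x) \<and> (0, 1) \<bullet> x = real m} \<subseteq>
      (\<lambda>x. (x, real m)) ` {x. x \<in> int_points \<and> (\<forall>e. 0 \<le> x $ e \<and> x $ e \<le> c)}"
    proof
      fix y assume y: "y \<in> {x \<in> ?S \<inter> int_vecs. (\<forall>\<phi>\<in>?\<Phi>. 0 \<le> \<phi> \<bullet> x) \<and> (0, 1) \<bullet> x = real m}"
      obtain x n where xn: "y = (x, n)" by fastforce
      then have n: "n = real m" using y by simp
      have x: "(x, real m) \<in> ?S" "(x, real m) \<in> int_vecs" "\<forall>\<phi>\<in>?\<Phi>. 0 \<le> \<phi> \<bullet> (x, real m)"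
        using y unfolding xn n by auto
      have "0 \<le> x $ e \<and> x $ e \<le> c" for e
      proof (cases "e \<in> F")
        case True
        have "real (l e) + 1 \<le> (\<Sum>e\<in>UNIV. real (l e) + 1)" by (rule member_le_sum) auto
        then have "(real (l e) + 1) * real m \<le> c" unfolding c_def by (intro mult_right_mono) auto
        moreover have "real (l e) * real m \<ge> 0" by simp
        moreover have "real (l e) * real m \<le> x $ e" "x $ e \<le> (real (l e) + 1) * real m"
          using x(3) True unfolding ball by blast+
        ultimately show ?thesis by linarith
      next
        case False
        then have "x $ e = 0" using x(1) unfolding flow_cone_def coord_subspace_def by blast
        then show ?thesis by (simp add: c_def sum_nonneg)
      qed
      then show "y \<in> (\<lambda>x. (x, real m)) ` {x. x \<in> int_points \<and> (\<forall>e. 0 \<le> x $ e \<and> x $ e \<le> c)}"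
        using x(2) by (auto simp: xn n int_vecs_Pair int_vecs_vec)
    qed
    then show ?thesis by (rule finite_subset) (intro finite_imageI finite_bounded_int_points)
  qed
  have face: "\<exists>v\<in>?S \<inter> int_vecs. (0, 1) \<bullet> v = 1 \<and>
      (\<forall>\<phi>\<in>?\<Phi>. \<phi> \<bullet> v \<in> {0, 1} \<and> (\<phi> \<bullet> (x, m) = 0 \<longrightarrow> \<phi> \<bullet> v = 0))"
    if x: "(x, m) \<in> ?S" "\<forall>\<phi>\<in>?\<Phi>. 0 \<le> \<phi> \<bullet> (x, m)" "(x, m) \<noteq> 0" for x m
  proof -
    have m: "m > 0" by (rule pos[OF x])
    define y where "y = (1 / m) *\<^sub>R x"
    have y: "margins y = demand k" "y \<in> coord_subspace F"
      using x(1) m unfolding y_def flow_cone_def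
      by (auto simp: linear_scale[OF linear_margins] subspace_scale[OF subspace_coord_subspace])
    have "margins y \<in> int_points" using y demand_int_points by metis
    then obtain v where v: "v \<in> int_points" "v \<in> coord_subspace F" "margins v = demand k"
      "\<And>e. of_int \<lfloor>y $ e\<rfloor> \<le> v $ e" "\<And>e. v $ e \<le> of_int \<lceil>y $ e\<rceil>"
      using flow_rounding_supported[OF _ y(2)] unfolding y(1) by blast
    have "(v, 1) \<in> ?S \<inter> int_vecs" using v by (simp add: flow_cone_def int_vecs_Pair int_vecs_vec)
    moreover have "\<forall>\<phi>\<in>?\<Phi>. \<phi> \<bullet> (v, 1) \<in> {0, 1} \<and> (\<phi> \<bullet> (x, m) = 0 \<longrightarrow> \<phi> \<bullet> (v, 1) = 0)"
      unfolding box_constraints_ball[of F l "\<lambda>a b. a \<in> {0, 1} \<and> (b = 0 \<longrightarrow> a = 0)" v 1 x m]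
    proof
      fix e assume "e \<in> F"
      then have "real (l e) * m \<le> x $ e" "x $ e \<le> (real (l e) + 1) * m" using x(2) unfolding ball by auto
      then have b: "real (l e) \<le> y $ e" "y $ e \<le> real (l e) + 1"
        using m by (simp_all add: y_def field_simps)
      then have "int (l e) \<le> \<lfloor>y $ e\<rfloor>" "\<lceil>y $ e\<rceil> \<le> int (l e) + 1" by linarith+
      moreover obtain z where z: "v $ e = of_int z"
        using Ints_cases[OF int_points_nth[OF v(1), of e]] by blast
      ultimately have zl: "int (l e) \<le> z" "z \<le> int (l e) + 1"
        using v(4)[of e] v(5)[of e] by linarith+
      have xy: "x $ e = y $ e * m" using m by (simp add: y_def)
      have "z = int (l e)" if "x $ e - real (l e) * m = 0"
      proof -
        have "y $ e = real (l e)" using that m xy by simp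
        then show ?thesis using v(5)[of e] z zl by simp
      qed
      moreover have "z = int (l e) + 1" if "(real (l e) + 1) * m - x $ e = 0"
      proof -
        have "y $ e = of_int (int (l e) + 1)" using that m xy by simp
        then show ?thesis using v(4)[of e] z zl by (simp only: floor_of_int)
      qed
      moreover have "z = int (l e) \<or> z = int (l e) + 1" using zl by linarith
      ultimately show "(v $ e - real (l e) * 1 \<in> {0, 1} \<and> (x $ e - real (l e) * m = 0 \<longrightarrow> v $ e - real (l e) * 1 = 0)) \<and>
        ((real (l e) + 1) * 1 - v $ e \<in> {0, 1} \<and>
        ((real (l e) + 1) * m - x $ e = 0 \<longrightarrow> (real (l e) + 1) * 1 - v $ e = 0))"
        unfolding z by auto
    qed
    ultimately show ?thesis by (intro bexI[of _ "(v, 1)"]) auto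
  qed
  have "?\<Phi> \<subseteq> int_vecs"
    by (auto simp: box_constraints_def int_vecs_Pair axis_int_vecs intro!: int_vecs_uminus)
  moreover have "(0 :: real ^ ('n \<times> 'n), 1 :: real) \<in> int_vecs" by (simp add: int_vecs_Pair int_vecs_zero)
  moreover have "finite ?\<Phi>" by (simp add: box_constraints_def)
  ultimately show ?thesis
    unfolding compressed_cone_def using subspace_flow_cone pos fin face by (auto 0 3)
qed

subsection \<open>Polynomiality and reciprocity\<close>

text \<open>
  Lattice flows of height \<open>m\<close> that lie in the polytope or, in the second case, in its interior,
  according to whether \<open>u\<close> is positive or negative on \<open>F\<close>.
\<close>

definition perturbed_flows ::
  "('n::finite \<times> 'n) set \<Rightarrow> ('n \<Rightarrow> nat) \<Rightarrow> real ^ ('n \<times> 'n) \<Rightarrow> nat \<Rightarrow> (real ^ ('n \<times> 'n)) set" where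
  "perturbed_flows F k u m = {x \<in> int_points \<inter> coord_subspace F.
     margins x = real m *\<^sub>R demand k \<and> (\<forall>e\<in>F. lex_nonneg (x $ e) (u $ e))}"

text \<open>
  On an edge where \<open>x e\<close> is forced to be a constant multiple of \<open>m\<close>, two adjacent boxes contain
  the same points; the last condition selects one of them.
\<close>

definition box_index :: "('n::finite \<times> 'n) set \<Rightarrow> ('n \<Rightarrow> nat) \<Rightarrow> real ^ ('n \<times> 'n) \<Rightarrow> real \<Rightarrow> ('n \<times> 'n \<Rightarrow> nat) set" where
  "box_index F k u h = {l \<in> F \<rightarrow>\<^sub>E {..sum k UNIV}. \<forall>e\<in>F. (real (l e) + 1) * h \<noteq> u $ e}"

section \<open>Assigning every lattice flow to exactly one box\<close>

lemma lex_nonneg_lower_bound: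
  assumes "lex_nonneg (x - real l * real m) (u - real l * h)" "m \<ge> 1"
  shows "lex_nonneg x u"
proof (cases "l = 0")
  case False
  then have "real l * real m > 0" using assms(2) by simp
  then show ?thesis using lex_nonneg_fst[OF assms(1)] by (simp add: lex_nonneg_def)
qed (use assms in simp)

text \<open>Boxes with a common point are adjacent and the point lies on their common wall. There
  the sign of \<open>(l + 1) * h - u\<close> selects a side, and the value 0 is excluded by
  hypothesis.\<close>

lemma lex_box_unique:
  assumes "m \<ge> 1" "l < l'"
    and "lex_nonneg ((real l + 1) * real m - x) ((real l + 1) * h - u)" "(real l + 1) * h \<noteq> u"
    and "lex_nonneg (x - real l' * real m) (u - real l' * h)"
  shows False
proof -
  have "real l' * real m \<le> (real l + 1) * real m"
    using lex_nonneg_fst[OF assms(3)] lex_nonneg_fst[OF assms(5)] by linarith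
  then have "real l' \<le> real l + 1" using assms(1) by simp
  then have "real l' = real l + 1" using assms(2) by linarith
  then show False using assms(3-5) by (auto simp: lex_nonneg_def)
qed

text \<open>Division of \<open>x\<close> by \<open>m\<close> yields the box \<open>q\<close>, except
  when \<open>x\<close> lies on the lower wall and the perturbation points below it; then the box
  \<open>q - 1\<close> is right, and \<open>q = 0\<close> is ruled out by
  \<open>lex_nonneg x u\<close>. The assumption \<open>gen\<close> is what genericity provides for a
  wall through \<open>(u, h)\<close>.\<close>

lemma ex_lex_box:
  fixes x u h :: real
  assumes "m \<ge> 1" "x \<in> \<int>" "lex_nonneg x u"
    and gen: "\<And>n::nat. (real n + 1) * h = u \<Longrightarrow> x = (real n + 1) * real m"
  shows "\<exists>l. lex_nonneg (x - real l * real m) (u - real l * h) \<and>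
    lex_nonneg ((real l + 1) * real m - x) ((real l + 1) * h - u) \<and> (real l + 1) * h \<noteq> u"
proof -
  obtain X where X: "x = real X"
    using assms(2) lex_nonneg_fst[OF assms(3)] by (metis Ints_cases of_int_0_le_iff of_int_of_nat_eq zero_le_imp_eq_int)
  define q where "q = X div m"
  have X1: "x = real q * real m + real (X mod m)" unfolding X q_def
    by (metis div_mult_mod_eq of_nat_add of_nat_mult)
  have X2: "real (X mod m) < real m" using assms(1) by simp
  show ?thesis
  proof (cases "X mod m > 0 \<or> u \<ge> real q * h")
    case True
    have "(real q + 1) * real m - x > 0" using X1 X2 by (simp add: algebra_simps)
    moreover have "(real q + 1) * h \<noteq> u" using gen[of q] calculation by auto
    moreover have "lex_nonneg (x - real q * real m) (u - real q * h)"
      using True X1 by (auto simp: lex_nonneg_def)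
    ultimately show ?thesis by (intro exI[of _ q]) (simp add: lex_nonneg_def)
  next
    case False
    then have x: "x = real q * real m" using X1 by simp
    have "q \<noteq> 0"
    proof
      assume "q = 0"
      then show False using False assms(3) x by (simp add: lex_nonneg_def)
    qed
    then obtain p where p: "q = Suc p" by (cases q) auto
    show ?thesis using False assms(1)
      by (intro exI[of _ p]) (simp add: x p lex_nonneg_def algebra_simps)
  qed
qed

lemma nonneg_flow_bounds:
  assumes "x \<in> coord_subspace F" "margins x = c *\<^sub>R demand k" "c \<ge> 0" "\<And>e. e \<in> F \<Longrightarrow> x $ e \<ge> 0"
  shows "0 \<le> x $ e" "x $ e \<le> c * real (sum k UNIV)"
proof -
  have nonneg: "x $ e \<ge> 0" for e
  proof (cases "e \<in> F")
    case False
    then have "x $ e = 0" using assms(1) unfolding coord_subspace_def by blast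
    then show ?thesis by simp
  qed (use assms in auto)
  then show "0 \<le> x $ e" .
  obtain j i where ji: "e = (j, i)" by fastforce
  have "x $ (j, i) \<le> (\<Sum>j\<in>UNIV. x $ (j, i))" by (rule member_le_sum) (auto simp: nonneg)
  also have "\<dots> = c * real (k i)"
    using arg_cong[OF assms(2), of "\<lambda>y. y $ Inl i"] by (simp add: margins_Inl demand_def)
  also have "k i \<le> sum k UNIV" by (rule member_le_sum) auto
  then have "c * real (k i) \<le> c * real (sum k UNIV)" using assms(3) by (intro mult_left_mono of_nat_mono)
  finally show "x $ e \<le> c * real (sum k UNIV)" by (simp add: ji)
qed

lemma card_perturbed_flows:
  fixes F :: "('n::finite \<times> 'n) set"
  assumes F: "F \<noteq> {}" and gen: "generic_in (flow_cone F k) (u, h)" and m: "m \<ge> 1"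
  shows "card (perturbed_flows F k u m) =
    (\<Sum>l\<in>box_index F k u h. card (slice (0, 1) (box_constraints F l) (flow_cone F k) (u, h) m))"
proof -
  let ?S = "flow_cone F k"
  let ?Y = "\<lambda>l. slice (0, 1) (box_constraints F l) ?S (u, h) m"
  have Y: "(x, n) \<in> ?Y l \<longleftrightarrow> n = real m \<and> x \<in> int_points \<inter> coord_subspace F \<and> margins x = real m *\<^sub>R demand k \<and>
      (\<forall>e\<in>F. lex_nonneg (x $ e - real (l e) * real m) (u $ e - real (l e) * h) \<and>
         lex_nonneg ((real (l e) + 1) * real m - x $ e) ((real (l e) + 1) * h - u $ e))" for x n l
    unfolding slice_def half_open_cone_def
    using box_constraints_ball[of F l lex_nonneg x n u h]
    by (auto simp: int_vecs_Pair int_vecs_vec flow_cone_def)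
  have disj: "?Y l \<inter> ?Y l' = {}" if l: "l \<in> box_index F k u h" "l' \<in> box_index F k u h" "l \<noteq> l'" for l l'
  proof (rule ccontr)
    assume "\<not> ?thesis"
    then obtain x n where x: "(x, n) \<in> ?Y l" "(x, n) \<in> ?Y l'" by fastforce
    have "l e = l' e" for e
    proof (cases "e \<in> F")
      case False
      then show ?thesis using l PiE_arb[of l F _ e] PiE_arb[of l' F _ e] unfolding box_index_def by fastforce
    next
      case True
      then have "\<not> l e < l' e" "\<not> l' e < l e"
        using x l lex_box_unique[OF m, of "l e" "l' e" "x $ e" h "u $ e"]
          lex_box_unique[OF m, of "l' e" "l e" "x $ e" h "u $ e"]
        unfolding Y box_index_def by blast+
      then show ?thesis by simp
    qed
    then show False using l(3) by blast
  qed
  have "(\<lambda>x. (x, real m)) ` perturbed_flows F k u m = (\<Union>l\<in>box_index F k u h. ?Y l)"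
  proof (intro equalityI subsetI)
    fix z assume "z \<in> (\<lambda>x. (x, real m)) ` perturbed_flows F k u m"
    then obtain x where z: "z = (x, real m)" and x: "x \<in> int_points" "x \<in> coord_subspace F"
      "margins x = real m *\<^sub>R demand k" "\<And>e. e \<in> F \<Longrightarrow> lex_nonneg (x $ e) (u $ e)"
      unfolding perturbed_flows_def by blast
    have xS: "(x, real m) \<in> ?S" using x by (simp add: flow_cone_def)
    have "\<exists>l. lex_nonneg (x $ e - real l * real m) (u $ e - real l * h) \<and>
        lex_nonneg ((real l + 1) * real m - x $ e) ((real l + 1) * h - u $ e) \<and> (real l + 1) * h \<noteq> u $ e"
      if e: "e \<in> F" for e
    proof (rule ex_lex_box[OF m int_points_nth[OF x(1)] x(4)[OF e]])
      \<comment> \<open>A wall through the generic vector contains the whole of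
        \<open>flow_cone F k\<close>, in particular the given point.\<close>
      fix n :: nat assume n: "(real n + 1) * h = u $ e"
      let ?\<psi> = "(- axis e 1, real n + 1) :: (real ^ ('n \<times> 'n)) \<times> real"
      have "?\<psi> \<in> int_vecs" by (simp add: int_vecs_Pair int_vecs_uminus axis_int_vecs)
      moreover have "?\<psi> \<bullet> (u, h) = 0" using n by (simp add: inner_axis')
      ultimately have "?\<psi> \<bullet> (x, real m) = 0" using gen xS unfolding generic_in_def by blast
      then show "x $ e = (real n + 1) * real m" by (simp add: inner_axis')
    qed
    then obtain l where l: "\<And>e. e \<in> F \<Longrightarrow> lex_nonneg (x $ e - real (l e) * real m) (u $ e - real (l e) * h)"
      "\<And>e. e \<in> F \<Longrightarrow> lex_nonneg ((real (l e) + 1) * real m - x $ e) ((real (l e) + 1) * h - u $ e)"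
      "\<And>e. e \<in> F \<Longrightarrow> (real (l e) + 1) * h \<noteq> u $ e"
      by metis
    have "l e \<le> sum k UNIV" if e: "e \<in> F" for e
    proof -
      have "real (l e) * real m \<le> x $ e" using lex_nonneg_fst[OF l(1)[OF e]] by simp
      also have "\<dots> \<le> real m * real (sum k UNIV)"
        by (rule nonneg_flow_bounds(2)[OF x(2,3)]) (use x(4) lex_nonneg_fst in auto)
      finally show ?thesis using m by (simp add: mult.commute del: of_nat_sum)
    qed
    then have "restrict l F \<in> box_index F k u h" using l(3) by (auto simp: box_index_def)
    moreover have "z \<in> ?Y (restrict l F)" unfolding z Y using x l by simp
    ultimately show "z \<in> (\<Union>l\<in>box_index F k u h. ?Y l)" by blast
  next
    fix z assume "z \<in> (\<Union>l\<in>box_index F k u h. ?Y l)"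
    then obtain l x n where z: "z = (x, n)" "(x, n) \<in> ?Y l" by (metis UN_E surj_pair)
    then have "x \<in> perturbed_flows F k u m" "n = real m"
      unfolding perturbed_flows_def Y using lex_nonneg_lower_bound[OF _ m] by blast+
    then show "z \<in> (\<lambda>x. (x, real m)) ` perturbed_flows F k u m" using z by blast
  qed
  moreover have "inj_on (\<lambda>x. (x, real m)) (perturbed_flows F k u m)" by (simp add: inj_on_def)
  ultimately have "card (perturbed_flows F k u m) = card (\<Union>l\<in>box_index F k u h. ?Y l)"
    by (metis card_image)
  also have "\<dots> = (\<Sum>l\<in>box_index F k u h. card (?Y l))"
  proof (rule card_UN_disjoint)
    show "finite (box_index F k u h)"
      by (rule finite_subset[of _ "F \<rightarrow>\<^sub>E {..sum k UNIV}"]) (auto simp: box_index_def intro: finite_PiE)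
    show "\<forall>l\<in>box_index F k u h. finite (?Y l)" using finite_slice[OF compressed_flow_box[OF F]] by blast
    show "\<forall>l\<in>box_index F k u h. \<forall>l'\<in>box_index F k u h. l \<noteq> l' \<longrightarrow> ?Y l \<inter> ?Y l' = {}"
      using disj by blast
  qed
  finally show ?thesis .
qed

definition lattice_flows :: "('n::finite \<times> 'n) set \<Rightarrow> ('n \<Rightarrow> nat) \<Rightarrow> nat \<Rightarrow> (real ^ ('n \<times> 'n)) set" where
  "lattice_flows F k m = {x \<in> int_points \<inter> coord_subspace F.
     margins x = real m *\<^sub>R demand k \<and> (\<forall>e\<in>F. x $ e \<ge> 0)}"

definition interior_lattice_flows :: "('n::finite \<times> 'n) set \<Rightarrow> ('n \<Rightarrow> nat) \<Rightarrow> nat \<Rightarrow> (real ^ ('n \<times> 'n)) set" where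
  "interior_lattice_flows F k m = {x \<in> int_points \<inter> coord_subspace F.
     margins x = real m *\<^sub>R demand k \<and> (\<forall>e\<in>F. x $ e > 0)}"

text \<open>The closed and the interior count are thus sums over the same boxes, so the reciprocity
  pairs of the single boxes can be added.\<close>

lemma box_index_uminus: "box_index F k (- u) (- h) = box_index F k u h"
  unfolding box_index_def by (simp add: algebra_simps) (metis minus_equation_iff)

text \<open>A generic vector near \<open>(a, 1)\<close> is positive on \<open>F\<close>, so it
  points inwards through every wall \<open>x $ e = 0\<close> and its negative points outwards. The
  height adds one dimension to the circulations, which turns \<open>- ((-1) ^ dim S)\<close> into
  the stated sign.\<close>

lemma lattice_flows_reciprocity:
  fixes F :: "('n::finite \<times> 'n) set"
  assumes F: "F \<noteq> {}" and a: "a \<in> coord_subspace F" "margins a = demand k" "\<And>e. e \<in> F \<Longrightarrow> a $ e > 0"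
  shows "\<exists>p. (\<forall>i>dim (circulations F). coeff p i = 0) \<and>
    (\<forall>m\<ge>1. poly p (real m) = real (card (lattice_flows F k m))) \<and>
    (\<forall>m\<ge>1. poly p (- real m) = (-1) ^ dim (circulations F) * real (card (interior_lattice_flows F k m)))"
proof -
  let ?S = "flow_cone F k"
  have aS: "(a, 1) \<in> ?S" using a by (simp add: flow_cone_def)
  \<comment> \<open>The least entry of \<open>a\<close> on \<open>F\<close>: a perturbation smaller
    than this stays positive there.\<close>
  define \<epsilon> where "\<epsilon> = Min ((\<lambda>e. a $ e) ` F)"
  have \<epsilon>: "\<epsilon> > 0" "\<And>e. e \<in> F \<Longrightarrow> \<epsilon> \<le> a $ e" using F a(3) by (auto simp: \<epsilon>_def)
  obtain w where w: "generic_in ?S w" "norm (w - (a, 1)) < \<epsilon>"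
    using ex_generic_near[OF subspace_flow_cone aS \<epsilon>(1)] by blast
  obtain u h where uh: "w = (u, h)" by fastforce
  have u: "u $ e > 0" if "e \<in> F" for e
  proof -
    have "\<bar>(u - a) $ e\<bar> \<le> norm (u - a)" by (rule component_le_norm_cart)
    also have "\<dots> \<le> norm (w - (a, 1))" using norm_fst_le[of "u - a" "h - 1"] by (simp add: uh)
    finally show ?thesis using w(2) \<epsilon>(2)[OF that] by simp
  qed
  have gen: "generic_in ?S (u, h)" "generic_in ?S (- u, - h)"
    using w generic_in_uminus[OF subspace_flow_cone w(1)] by (simp_all add: uh)
  have closed: "perturbed_flows F k u m = lattice_flows F k m" for m
  proof -
    have "lex_nonneg (x $ e) (u $ e) \<longleftrightarrow> x $ e \<ge> 0" if "e \<in> F" for x e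
      using u[OF that] by (auto simp: lex_nonneg_def)
    then show ?thesis unfolding perturbed_flows_def lattice_flows_def
      by (intro Collect_cong conj_cong refl ball_cong)
  qed
  have "open": "perturbed_flows F k (- u) m = interior_lattice_flows F k m" for m
  proof -
    have "lex_nonneg (x $ e) ((- u) $ e) \<longleftrightarrow> x $ e > 0" if "e \<in> F" for x e
      using u[OF that] by (auto simp: lex_nonneg_def)
    then show ?thesis unfolding perturbed_flows_def interior_lattice_flows_def
      by (intro Collect_cong conj_cong refl ball_cong)
  qed
  let ?I = "box_index F k u h"
  have "finite ?I"
    by (rule finite_subset[of _ "F \<rightarrow>\<^sub>E {..sum k UNIV}"]) (auto simp: box_index_def intro: finite_PiE)
  then have "ehrhart_pair (dim ?S)
      (\<lambda>m. \<Sum>l\<in>?I. card (slice (0, 1) (box_constraints F l) ?S (u, h) m))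
      (\<lambda>m. \<Sum>l\<in>?I. card (slice (0, 1) (box_constraints F l) ?S (- (u, h)) m))"
    using ehrhart_pair_slice[OF compressed_flow_box[OF F] gen(1)] by (intro ehrhart_pair_sum)
  then obtain p :: "real poly" where p: "\<forall>i\<ge>dim ?S. coeff p i = 0"
    "\<forall>m\<ge>1. poly p (real m) = real (\<Sum>l\<in>?I. card (slice (0, 1) (box_constraints F l) ?S (u, h) m))"
    "\<forall>m\<ge>1. poly p (- real m) = - ((-1) ^ dim ?S) * real (\<Sum>l\<in>?I. card (slice (0, 1) (box_constraints F l) ?S (- (u, h)) m))"
    unfolding ehrhart_pair_def by blast
  have "card (lattice_flows F k m) = (\<Sum>l\<in>?I. card (slice (0, 1) (box_constraints F l) ?S (u, h) m))"
    if "m \<ge> 1" for m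
    using card_perturbed_flows[OF F gen(1) that] by (simp add: closed)
  moreover have "card (interior_lattice_flows F k m) = (\<Sum>l\<in>?I. card (slice (0, 1) (box_constraints F l) ?S (- (u, h)) m))"
    if "m \<ge> 1" for m
    using card_perturbed_flows[OF F gen(2) that] by (simp add: "open" box_index_uminus)
  ultimately show ?thesis
    using p unfolding dim_flow_cone[OF aS] by (intro exI[of _ p]) (auto simp: Suc_le_eq)
qed

subsection \<open>Geometry of the flow polytope\<close>

text \<open>The two shifts are the constants by which heights and cube sizes differ in the volume
  comparison; they do not affect the limit.\<close>

lemma poly_scaled_limit:
  fixes p :: "real poly"
  assumes "\<forall>i>d. coeff p i = 0"
  shows "(\<lambda>m. poly p (real m + b) / (real m + c) ^ d) \<longlonglongrightarrow> coeff p d"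
proof -
  have lim0: "(\<lambda>m. 1 / (real m + c)) \<longlonglongrightarrow> 0"
    by real_asymp
  have lim1: "(\<lambda>m. (real m + b) / (real m + c)) \<longlonglongrightarrow> 1"
    by real_asymp
  have "(\<lambda>m. \<Sum>i\<le>d. coeff p i * (((real m + b) / (real m + c)) ^ i * (1 / (real m + c)) ^ (d - i)))
      \<longlonglongrightarrow> (\<Sum>i\<le>d. coeff p i * (1 ^ i * 0 ^ (d - i)))"
    by (intro tendsto_sum tendsto_mult tendsto_const tendsto_power lim0 lim1)
  also have "(\<Sum>i\<le>d. coeff p i * (1 ^ i * 0 ^ (d - i))) = (\<Sum>i\<le>d. if i = d then coeff p d else 0)"
    by (intro sum.cong refl) (auto simp: power_0_left)
  also have "\<dots> = coeff p d" by simp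
  finally show ?thesis
  proof (rule Lim_transform_eventually)
    have "degree p \<le> d" using assms by (intro degree_le) auto
    have "eventually (\<lambda>m. real m > - c) sequentially" by real_asymp
    then show "\<forall>\<^sub>F m in sequentially. (\<Sum>i\<le>d. coeff p i * (((real m + b) / (real m + c)) ^ i * (1 / (real m + c)) ^ (d - i)))
        = poly p (real m + b) / (real m + c) ^ d"
    proof eventually_elim
      case (elim m)
      then have nz: "real m + c \<noteq> 0" by simp
      have "poly p (real m + b) = (\<Sum>i\<le>d. coeff p i * (real m + b) ^ i)"
        unfolding poly_altdef using \<open>degree p \<le> d\<close>
        by (intro sum.mono_neutral_left) (auto simp: coeff_eq_0)
      moreover have "((real m + b) / (real m + c)) ^ i * (1 / (real m + c)) ^ (d - i) = (real m + b) ^ i / (real m + c) ^ d"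
        if "i \<le> d" for i
        using that nz by (simp add: power_divide flip: power_add)
      ultimately show ?case by (simp add: sum_divide_distrib)
    qed
  qed
qed

lemma finite_lattice_flows: "finite (lattice_flows F k m)"
proof (rule finite_subset)
  show "lattice_flows F k m \<subseteq> {x. x \<in> int_points \<and> (\<forall>e. 0 \<le> x $ e \<and> x $ e \<le> real m * real (sum k UNIV))}"
  proof
    fix x assume "x \<in> lattice_flows F k m"
    then have x: "x \<in> int_points" "x \<in> coord_subspace F" "margins x = real m *\<^sub>R demand k"
      "\<And>e. e \<in> F \<Longrightarrow> x $ e \<ge> 0"
      unfolding lattice_flows_def by blast+
    show "x \<in> {x. x \<in> int_points \<and> (\<forall>e. 0 \<le> x $ e \<and> x $ e \<le> real m * real (sum k UNIV))}"
      using x(1) nonneg_flow_bounds[OF x(2,3)] x(4) by simp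
  qed
qed (rule finite_bounded_int_points)

section \<open>Dilates, relative interior and affine hull of the flow polytope\<close>

lemma flow_polytope_eq:
  "flow_polytope F k = {x \<in> coord_subspace F. margins x = demand k \<and> (\<forall>e\<in>F. x $ e \<ge> 0)}"
proof -
  have in_sum: "(\<Sum>j | (j, i) \<in> F. x $ (j, i)) = (\<Sum>j\<in>UNIV. x $ (j, i))"
    and out_sum: "(\<Sum>i | (j, i) \<in> F. x $ (j, i)) = (\<Sum>i\<in>UNIV. x $ (j, i))"
    if "\<forall>e. e \<notin> F \<longrightarrow> x $ e = 0" for x :: "real ^ ('a \<times> 'a)" and i j
    using that by (auto intro!: sum.mono_neutral_left)
  have "margins x = demand k \<longleftrightarrow> (\<forall>i. (\<Sum>j\<in>UNIV. x $ (j, i)) = real (k i)) \<and> (\<forall>j. (\<Sum>i\<in>UNIV. x $ (j, i)) = real (k j))"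
    for x :: "real ^ ('a \<times> 'a)"
    unfolding vec_eq_iff split_sum_all by (simp add: margins_Inl margins_Inr demand_def)
  moreover have "(\<forall>e. x $ e \<ge> 0) \<longleftrightarrow> (\<forall>e\<in>F. x $ e \<ge> 0)" if "\<forall>e. e \<notin> F \<longrightarrow> x $ e = 0"
    for x :: "real ^ ('a \<times> 'a)"
    using that by (metis order_refl)
  ultimately show ?thesis
    unfolding flow_polytope_def coord_subspace_def by (intro Collect_eqI) (use in_sum out_sum in auto)
qed

lemma demand_mult: "demand (\<lambda>i. m * k i) = real m *\<^sub>R demand k"
  by (rule vec_sum_eqI) (simp_all add: demand_def)

lemma dilate_flow_polytope:
  assumes "m \<ge> 1"
  shows "dilate m (flow_polytope F k) = flow_polytope F (\<lambda>i. m * k i)"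
proof (intro equalityI subsetI)
  fix x assume "x \<in> dilate m (flow_polytope F k)"
  then show "x \<in> flow_polytope F (\<lambda>i. m * k i)"
    unfolding dilate_def flow_polytope_eq demand_mult
    by (auto simp: linear_scale[OF linear_margins] subspace_scale[OF subspace_coord_subspace])
next
  fix x assume x: "x \<in> flow_polytope F (\<lambda>i. m * k i)"
  have "(1 / real m) *\<^sub>R x \<in> flow_polytope F k"
    using x assms unfolding flow_polytope_eq demand_mult
    by (auto simp: linear_scale[OF linear_margins] subspace_scale[OF subspace_coord_subspace])
  moreover have "x = real m *\<^sub>R ((1 / real m) *\<^sub>R x)" using assms by simp
  ultimately show "x \<in> dilate m (flow_polytope F k)" unfolding dilate_def by blast
qed

lemma dilate_flow_polytope_int_points:
  "m \<ge> 1 \<Longrightarrow> dilate m (flow_polytope F k) \<inter> int_points = lattice_flows F k m"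
  by (simp only: dilate_flow_polytope) (auto simp: flow_polytope_eq demand_mult lattice_flows_def)

lemma convex_flow_polytope: "convex (flow_polytope F k)"
  unfolding convex_def flow_polytope_eq
  by (auto simp: linear_add[OF linear_margins] linear_scale[OF linear_margins]
      subspace_add[OF subspace_coord_subspace] subspace_scale[OF subspace_coord_subspace] simp flip: scaleR_add_left)

text \<open>A relative interior point can be passed slightly when coming from any point of the
  polytope. Coming from the positive flow \<open>a\<close>, this forces positive entries;
  conversely, finitely many strict inequalities survive a small extension.\<close>

lemma rel_interior_flow_polytope:
  assumes a: "a \<in> flow_polytope F k" "\<And>e. e \<in> F \<Longrightarrow> a $ e > 0"
  shows "rel_interior (flow_polytope F k) = {x \<in> flow_polytope F k. \<forall>e\<in>F. x $ e > 0}"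
proof -
  let ?P = "flow_polytope F k"
  have iff: "z \<in> rel_interior ?P \<longleftrightarrow> (\<forall>x\<in>?P. \<exists>e>1. (1 - e) *\<^sub>R x + e *\<^sub>R z \<in> ?P)" for z
    using convex_rel_interior_iff[OF convex_flow_polytope] a(1) by blast
  show ?thesis
  proof (intro equalityI subsetI)
    fix z assume z: "z \<in> rel_interior ?P"
    then obtain t where t: "t > 1" "(1 - t) *\<^sub>R a + t *\<^sub>R z \<in> ?P" using iff a(1) by blast
    have "z $ e > 0" if e: "e \<in> F" for e
    proof -
      have "(1 - t) * a $ e + t * z $ e \<ge> 0" using t(2) e by (auto simp: flow_polytope_eq)
      moreover have "(1 - t) * a $ e < 0" using t(1) a(2)[OF e] by (simp add: mult_neg_pos)
      ultimately have "t * z $ e > 0" by linarith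
      then show ?thesis using t(1) by (simp add: zero_less_mult_iff)
    qed
    then show "z \<in> {x \<in> ?P. \<forall>e\<in>F. x $ e > 0}" using z rel_interior_subset by blast
  next
    fix z assume z: "z \<in> {x \<in> ?P. \<forall>e\<in>F. x $ e > 0}"
    show "z \<in> rel_interior ?P" unfolding iff
    proof
      fix x assume x: "x \<in> ?P"
      have ev: "\<forall>\<^sub>F t in at_right 1. 0 < (1 - t) * x $ e + t * z $ e" if "e \<in> F" for e
      proof -
        have "((\<lambda>t. (1 - t) * x $ e + t * z $ e) \<longlongrightarrow> (1 - 1) * x $ e + 1 * z $ e) (at_right 1)"
          by (intro tendsto_intros)
        then show ?thesis using z that by (intro order_tendstoD(1)) auto
      qed
      have "\<forall>\<^sub>F t in at_right 1. \<forall>e\<in>F. 0 < (1 - t) * x $ e + t * z $ e"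
        using ev by (intro eventually_ball_finite) auto
      moreover have "\<forall>\<^sub>F t in at_right 1. t > (1 :: real)"
        by (simp add: eventually_at_filter)
      ultimately obtain t where t: "t > 1" "\<forall>e\<in>F. 0 < (1 - t) * x $ e + t * z $ e"
        using eventually_happens[OF eventually_conj] by (metis (mono_tags, lifting) trivial_limit_at_right_real)
      have "(1 - t) *\<^sub>R x + t *\<^sub>R z \<in> ?P" using x z t unfolding flow_polytope_eq
        by (auto simp: linear_add[OF linear_margins] linear_scale[OF linear_margins] less_imp_le
          subspace_add[OF subspace_coord_subspace] subspace_scale[OF subspace_coord_subspace] simp flip: scaleR_add_left)
      then show "\<exists>e>1. (1 - e) *\<^sub>R x + e *\<^sub>R z \<in> ?P" using t(1) by blast
    qed
  qed
qed

text \<open>From the positive flow \<open>a\<close> a short step towards any \<open>x\<close> with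
  the same margins stays in the polytope, and the line through \<open>a\<close> and the point
  reached contains \<open>x\<close>.\<close>

lemma affine_hull_flow_polytope:
  assumes a: "a \<in> flow_polytope F k" "\<And>e. e \<in> F \<Longrightarrow> a $ e > 0"
  shows "affine hull (flow_polytope F k) = {x \<in> coord_subspace F. margins x = demand k}"
proof (intro equalityI)
  show "affine hull flow_polytope F k \<subseteq> {x \<in> coord_subspace F. margins x = demand k}"
  proof (rule hull_minimal)
    show "flow_polytope F k \<subseteq> {x \<in> coord_subspace F. margins x = demand k}"
      by (auto simp: flow_polytope_eq)
    show "affine {x \<in> coord_subspace F. margins x = demand k}" unfolding affine_def
      by (auto simp: linear_add[OF linear_margins] linear_scale[OF linear_margins]
        subspace_add[OF subspace_coord_subspace] subspace_scale[OF subspace_coord_subspace] simp flip: scaleR_add_left)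
  qed
  show "{x \<in> coord_subspace F. margins x = demand k} \<subseteq> affine hull flow_polytope F k"
  proof
    fix x assume x: "x \<in> {x \<in> coord_subspace F. margins x = demand k}"
    have ev: "\<forall>\<^sub>F t in at_right 0. 0 < (1 - t) * a $ e + t * x $ e" if "e \<in> F" for e
    proof -
      have "((\<lambda>t. (1 - t) * a $ e + t * x $ e) \<longlongrightarrow> (1 - 0) * a $ e + 0 * x $ e) (at_right 0)"
        by (intro tendsto_intros)
      then show ?thesis using a(2)[OF that] by (intro order_tendstoD(1)) auto
    qed
    have "\<forall>\<^sub>F t in at_right 0. \<forall>e\<in>F. 0 < (1 - t) * a $ e + t * x $ e"
      using ev by (intro eventually_ball_finite) auto
    moreover have "\<forall>\<^sub>F t in at_right 0. t > (0 :: real)"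
      by (simp add: eventually_at_filter)
    ultimately obtain t where t: "t > 0" "\<forall>e\<in>F. 0 < (1 - t) * a $ e + t * x $ e"
      using eventually_happens[OF eventually_conj] by (metis (mono_tags, lifting) trivial_limit_at_right_real)
    define y where "y = (1 - t) *\<^sub>R a + t *\<^sub>R x"
    have "y \<in> flow_polytope F k" using a(1) x t unfolding flow_polytope_eq y_def
      by (auto simp: linear_add[OF linear_margins] linear_scale[OF linear_margins] less_imp_le
        subspace_add[OF subspace_coord_subspace] subspace_scale[OF subspace_coord_subspace] simp flip: scaleR_add_left)
    then have "(1 - 1 / t) *\<^sub>R a + (1 / t) *\<^sub>R y \<in> affine hull flow_polytope F k"
      using a(1) by (intro mem_affine affine_affine_hull hull_inc) auto
    moreover have "(1 - 1 / t) *\<^sub>R a + (1 / t) *\<^sub>R y = x"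
      using t(1) unfolding y_def by (simp add: vec_eq_iff field_simps)
    ultimately show "x \<in> affine hull flow_polytope F k" by simp
  qed
qed

lemma parallel_lattice_flow_polytope:
  assumes a: "a \<in> flow_polytope F k" "\<And>e. e \<in> F \<Longrightarrow> a $ e > 0"
  shows "parallel_lattice (flow_polytope F k) = int_points \<inter> circulations F"
proof -
  have H: "affine hull (flow_polytope F k) = {x \<in> coord_subspace F. margins x = demand k}"
    using affine_hull_flow_polytope a by blast
  have "{x - y | x y. x \<in> affine hull flow_polytope F k \<and> y \<in> affine hull flow_polytope F k} = circulations F"
  proof (intro equalityI subsetI)
    fix z assume "z \<in> {x - y | x y. x \<in> affine hull flow_polytope F k \<and> y \<in> affine hull flow_polytope F k}"
    then show "z \<in> circulations F" unfolding H
      by (auto simp: circulations_def linear_diff[OF linear_margins] subspace_diff[OF subspace_coord_subspace])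
  next
    fix z assume "z \<in> circulations F"
    then have "a + z \<in> coord_subspace F" "margins (a + z) = demand k" "a \<in> coord_subspace F" "margins a = demand k"
      using a(1) by (auto simp: circulations_def flow_polytope_eq linear_add[OF linear_margins]
          subspace_add[OF subspace_coord_subspace])
    moreover have "z = (a + z) - a" by simp
    ultimately show "z \<in> {x - y | x y. x \<in> affine hull flow_polytope F k \<and> y \<in> affine hull flow_polytope F k}"
      unfolding H by blast
  qed
  then show ?thesis unfolding parallel_lattice_def by simp
qed

subsection \<open>Leading coefficient and volume\<close>

text \<open>
  The half-open lattice cube at \<open>z\<close>, scaled by \<open>1 / m\<close>, in the coordinates whose origin is
  shifted by \<open>s\<close> from a lattice point.
\<close>

definition lattice_cube :: "'b set \<Rightarrow> ('b \<Rightarrow> real) \<Rightarrow> nat \<Rightarrow> ('b \<Rightarrow> int) \<Rightarrow> ('b \<Rightarrow> real) set" where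
  "lattice_cube B s m z = (\<Pi>\<^sub>E b\<in>B. {of_int (z b) / real m - s b ..< (of_int (z b) + 1) / real m - s b})"

lemma lattice_cube_iff:
  assumes "m \<ge> 1"
  shows "t \<in> lattice_cube B s m z \<longleftrightarrow> t \<in> extensional B \<and> (\<forall>b\<in>B. \<lfloor>real m * (t b + s b)\<rfloor> = z b)"
proof -
  have "t b \<in> {of_int (z b) / real m - s b ..< (of_int (z b) + 1) / real m - s b} \<longleftrightarrow>
      \<lfloor>real m * (t b + s b)\<rfloor> = z b" for b
  proof -
    have "\<lfloor>real m * (t b + s b)\<rfloor> = z b \<longleftrightarrow> of_int (z b) \<le> real m * (t b + s b) \<and> real m * (t b + s b) < of_int (z b) + 1"
      by (simp add: floor_eq_iff)
    also have "\<dots> \<longleftrightarrow> of_int (z b) / real m \<le> t b + s b \<and> t b + s b < (of_int (z b) + 1) / real m"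
      using assms by (simp add: field_simps)
    finally show ?thesis by auto
  qed
  then show ?thesis unfolding lattice_cube_def by (auto simp: PiE_def Pi_def)
qed

lemma lattice_cube_measure:
  assumes "finite B" "m \<ge> 1"
  shows "lattice_cube B s m z \<in> sets (PiM B (\<lambda>_. lborel))"
    and "emeasure (PiM B (\<lambda>_. lborel)) (lattice_cube B s m z) = ennreal ((1 / real m) ^ card B)"
proof -
  interpret product_sigma_finite "\<lambda>_ :: 'a. lborel :: real measure"
    by unfold_locales
  show "lattice_cube B s m z \<in> sets (PiM B (\<lambda>_. lborel))"
    unfolding lattice_cube_def using assms(1) by (intro sets_PiM_I_finite) auto
  have "emeasure (PiM B (\<lambda>_. lborel)) (lattice_cube B s m z) =
    (\<Prod>b\<in>B. emeasure lborel {of_int (z b) / real m - s b ..< (of_int (z b) + 1) / real m - s b})"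
    unfolding lattice_cube_def using assms(1) by (intro emeasure_PiM) auto
  also have "\<dots> = (\<Prod>b\<in>B. ennreal (1 / real m))"
    using assms(2) by (intro prod.cong refl) (simp add: divide_simps)
  also have "\<dots> = ennreal ((1 / real m) ^ card B)" by (simp add: ennreal_power)
  finally show "emeasure (PiM B (\<lambda>_. lborel)) (lattice_cube B s m z) = ennreal ((1 / real m) ^ card B)" .
qed

lemma lattice_cube_disjoint:
  assumes "m \<ge> 1" "z \<in> extensional B" "z' \<in> extensional B" "z \<noteq> z'"
  shows "lattice_cube B s m z \<inter> lattice_cube B s m z' = {}"
proof (rule ccontr)
  assume "\<not> ?thesis"
  then obtain t where "t \<in> lattice_cube B s m z" "t \<in> lattice_cube B s m z'" by blast
  then have "z b = z' b" if "b \<in> B" for b using that assms(1) by (auto simp: lattice_cube_iff)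
  then show False using extensionalityI[OF assms(2,3)] assms(4) by blast
qed

text \<open>
  Compares the polytope with the union of the small lattice cubes based at its lattice points.
  Enlarging the height by a constant \<open>C\<close>, which amounts to adding the interior lattice point
  \<open>C a\<close>, absorbs the cubes that meet the boundary.
\<close>

lemma flow_polytope_volume:
  fixes F :: "('n::finite \<times> 'n) set"
  assumes a: "a \<in> flow_polytope F k" "a \<in> int_points" "\<And>e. e \<in> F \<Longrightarrow> a $ e > 0"
    and p: "\<forall>i>dim (circulations F). coeff p i = 0"
      "\<forall>m\<ge>1. poly p (real m) = real (card (lattice_flows F k m))"
  shows "rel_lattice_volume (flow_polytope F k) = coeff p (dim (circulations F))"
    and "coeff p (dim (circulations F)) > 0"
proof -
  let ?P = "flow_polytope F k" and ?K = "circulations F"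
  define B where "B = (SOME B. lattice_basis (parallel_lattice ?P) B)"
  define x\<^sub>0 where "x\<^sub>0 = (SOME x. x \<in> ?P)"
  have PL: "parallel_lattice ?P = int_points \<inter> ?K"
    by (rule parallel_lattice_flow_polytope[OF a(1,3)])
  have B: "lattice_basis (int_points \<inter> ?K) B"
    unfolding B_def PL using circulations_lattice_basis[of F] by (metis someI)
  have x0: "x\<^sub>0 \<in> ?P" unfolding x\<^sub>0_def using a(1) by (rule someI)
  note spanB = circulations_lattice_basis_unique(1)[OF B]
  have cardB: "card B = dim ?K" by (rule circulations_lattice_basis_unique(2)[OF B])
  have indB: "independent B" and finB: "finite B"
    using B by (auto simp: lattice_basis_def independent_imp_finite)
  have BK: "b \<in> ?K" if "b \<in> B" for b using span_base[OF that] by (simp add: spanB)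
  have sumK: "(\<Sum>b\<in>B. c b *\<^sub>R b) \<in> ?K" for c :: "_ \<Rightarrow> real"
    by (intro subspace_sum subspace_scale subspace_circulations BK)
  have aff: "x + y \<in> coord_subspace F" "margins (x + y) = margins x"
    if "x \<in> coord_subspace F" "y \<in> ?K" for x y
    using that by (auto simp: circulations_def linear_add[OF linear_margins] subspace_add[OF subspace_coord_subspace])
  have aP: "a \<in> coord_subspace F" "margins a = demand k" using a(1) by (auto simp: flow_polytope_eq)
  have a1: "a $ e \<ge> 1" if e: "e \<in> F" for e
  proof -
    obtain z where "a $ e = of_int z" using Ints_cases[OF int_points_nth[OF a(2), of e]] by blast
    then show ?thesis using a(3)[OF e] by simp
  qed
  have "x\<^sub>0 - a \<in> ?K"
    using x0 aP by (auto simp: circulations_def flow_polytope_eq linear_diff[OF linear_margins]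
        subspace_diff[OF subspace_coord_subspace])
  \<comment> \<open>The origin \<open>x\<^sub>0\<close> of the coordinates is an arbitrary point of
    the polytope. The shift \<open>s\<close> aligns the cubes with the lattice through
    \<open>a\<close>.\<close>
  then obtain s where s: "x\<^sub>0 - a = (\<Sum>b\<in>B. s b *\<^sub>R b)"
    unfolding spanB[symmetric] span_finite[OF finB] by auto
  \<comment> \<open>Bounds, entry by entry, the displacement of a point of a lattice cube from its
    base corner.\<close>
  define C where "C = nat \<lceil>\<Sum>b\<in>B. \<Sum>e\<in>UNIV. \<bar>b $ e\<bar>\<rceil>"
  have C: "\<bar>(\<Sum>b\<in>B. \<theta> b *\<^sub>R b) $ e\<bar> \<le> real C" if "\<And>b. b \<in> B \<Longrightarrow> \<bar>\<theta> b\<bar> \<le> 1" for \<theta> :: "_ \<Rightarrow> real" and e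
  proof -
    have "\<bar>(\<Sum>b\<in>B. \<theta> b *\<^sub>R b) $ e\<bar> \<le> (\<Sum>b\<in>B. \<bar>\<theta> b * b $ e\<bar>)"
      by (simp add: sum_abs)
    also have "\<dots> \<le> (\<Sum>b\<in>B. \<Sum>e\<in>UNIV. \<bar>b $ e\<bar>)"
    proof (rule sum_mono)
      fix b assume "b \<in> B"
      then have "\<bar>\<theta> b * b $ e\<bar> \<le> 1 * \<bar>b $ e\<bar>" unfolding abs_mult using that by (intro mult_right_mono) auto
      also have "\<dots> \<le> (\<Sum>e\<in>UNIV. \<bar>b $ e\<bar>)" using member_le_sum[of e UNIV "\<lambda>e. \<bar>b $ e\<bar>"] by simp
      finally show "\<bar>\<theta> b * b $ e\<bar> \<le> (\<Sum>e\<in>UNIV. \<bar>b $ e\<bar>)" .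
    qed
    also have "\<dots> \<le> real C" unfolding C_def by (rule real_nat_ceiling_ge)
    finally show ?thesis .
  qed
  define pt where "pt = (\<lambda>m (z :: _ \<Rightarrow> int). real m *\<^sub>R a + (\<Sum>b\<in>B. of_int (z b) *\<^sub>R b))"
  define Z where "Z = (\<lambda>m. {z \<in> B \<rightarrow>\<^sub>E (UNIV :: int set). pt m z \<in> lattice_flows F k m})"
  have bij: "bij_betw (pt m) (Z m) (lattice_flows F k m)" for m
    unfolding bij_betw_def
  proof
    show "inj_on (pt m) (Z m)"
    proof (rule inj_onI)
      fix z z' assume z: "z \<in> Z m" "z' \<in> Z m" and eq: "pt m z = pt m z'"
      then have "(\<Sum>b\<in>B. (of_int (z b) - of_int (z' b)) *\<^sub>R b) = 0"
        by (simp add: pt_def scaleR_diff_left sum_subtractf)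
      then have "real_of_int (z b) - of_int (z' b) = 0" if "b \<in> B" for b
        using indB finB that unfolding independent_explicit by meson
      then show "z = z'" using z by (intro PiE_ext[of z B "\<lambda>_. UNIV" z']) (auto simp: Z_def)
    qed
    show "pt m ` Z m = lattice_flows F k m"
    proof (intro equalityI subsetI)
      fix x assume x: "x \<in> lattice_flows F k m"
      have "x - real m *\<^sub>R a \<in> int_points \<inter> ?K"
        using x a(2) aP unfolding lattice_flows_def circulations_def
        by (auto simp: int_points_def linear_diff[OF linear_margins] linear_scale[OF linear_margins]
            subspace_diff[OF subspace_coord_subspace] subspace_scale[OF subspace_coord_subspace])
      then obtain c where c: "x - real m *\<^sub>R a = (\<Sum>b\<in>B. of_int (c b) *\<^sub>R b)"
        using B unfolding lattice_basis_def by blast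
      then have "pt m (restrict c B) = x" by (simp add: pt_def algebra_simps)
      then show "x \<in> pt m ` Z m" using x by (intro image_eqI[of _ _ "restrict c B"]) (auto simp: Z_def)
    qed (auto simp: Z_def)
  qed
  have finZ: "finite (Z m)" and cardZ: "card (Z m) = card (lattice_flows F k m)" for m
    using bij_betw_finite[OF bij] finite_lattice_flows bij_betw_same_card[OF bij] by blast+
  define M where "M = PiM B (\<lambda>_. lborel :: real measure)"
  define T where "T = {t \<in> space M. x\<^sub>0 + (\<Sum>b\<in>B. t b *\<^sub>R b) \<in> ?P}"
  have spM: "space M = extensional B" by (auto simp: M_def space_PiM PiE_def)
  have T: "t \<in> T \<longleftrightarrow> t \<in> space M \<and> (\<forall>e\<in>F. 0 \<le> (x\<^sub>0 + (\<Sum>b\<in>B. t b *\<^sub>R b)) $ e)" for t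
    using x0 aff[OF _ sumK, of x\<^sub>0 t] unfolding T_def flow_polytope_eq by auto
  have TM: "T \<in> sets M"
  proof -
    have "T = {t \<in> space M. \<forall>e\<in>F. 0 \<le> x\<^sub>0 $ e + (\<Sum>b\<in>B. t b * b $ e)}" using T by (auto simp del: split_paired_All)
    also have "\<dots> \<in> sets M"
    proof (rule sets.sets_Collect_finite_All)
      fix e assume "e \<in> F"
      show "{t \<in> space M. 0 \<le> x\<^sub>0 $ e + (\<Sum>b\<in>B. t b * b $ e)} \<in> sets M"
        unfolding M_def by measurable
    qed simp
    finally show ?thesis .
  qed
  have decomp: "real m *\<^sub>R (x\<^sub>0 + (\<Sum>b\<in>B. t b *\<^sub>R b)) =
      pt m z + (\<Sum>b\<in>B. (real m * (t b + s b) - of_int (z b)) *\<^sub>R b)" for m t z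
  proof -
    have x: "x\<^sub>0 = a + (\<Sum>b\<in>B. s b *\<^sub>R b)" using s by (simp add: algebra_simps)
    show ?thesis unfolding x pt_def
      by (simp add: scaleR_sum_right sum.distrib sum_subtractf algebra_simps scaleR_add_left)
  qed
  have frac: "\<bar>real m * (t b + s b) - of_int (z b)\<bar> \<le> 1" if "\<lfloor>real m * (t b + s b)\<rfloor> = z b" for m t z b
    using that by linarith
  \<comment> \<open>Adding \<open>real C *\<^sub>R a\<close> raises each entry on \<open>F\<close>
    by at least \<open>C\<close> and leaves the index \<open>z\<close> unchanged, so cubes of side
    \<open>1 / m\<close> are counted by flows of height \<open>m + C\<close>.\<close>
  have upper: "T \<subseteq> (\<Union>z\<in>Z (m + C). lattice_cube B s m z)" if m: "m \<ge> 1" for m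
  proof
    fix t assume t: "t \<in> T"
    define z where "z = restrict (\<lambda>b. \<lfloor>real m * (t b + s b)\<rfloor>) B"
    let ?\<theta> = "\<lambda>b. real m * (t b + s b) - of_int (z b)"
    have pt: "pt (m + C) z = pt m z + real C *\<^sub>R a" by (simp add: pt_def algebra_simps)
    have "pt (m + C) z $ e \<ge> 0" if e: "e \<in> F" for e
    proof -
      have "0 \<le> real m * (x\<^sub>0 + (\<Sum>b\<in>B. t b *\<^sub>R b)) $ e" using t e by (auto simp: T)
      also have "\<dots> = pt m z $ e + (\<Sum>b\<in>B. ?\<theta> b *\<^sub>R b) $ e"
        using arg_cong[OF decomp[of m t z], of "\<lambda>y. y $ e"] by simp
      also have "(\<Sum>b\<in>B. ?\<theta> b *\<^sub>R b) $ e \<le> real C"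
        using C[of ?\<theta> e] frac[of m t _ z] by (auto simp: z_def)
      also have "real C \<le> real C * a $ e" using a1[OF e] mult_left_mono[of 1 "a $ e" "real C"] by simp
      finally show ?thesis by (simp add: pt)
    qed
    moreover have "pt (m + C) z \<in> int_points"
    proof -
      have "b \<in> int_points" if "b \<in> B" for b using lattice_basis_subset[OF B] that by blast
      then show ?thesis using a(2) unfolding pt_def int_points_def by (auto intro!: Ints_add Ints_mult Ints_sum)
    qed
    moreover have "pt (m + C) z \<in> coord_subspace F" "margins (pt (m + C) z) = real (m + C) *\<^sub>R demand k"
      using aff[OF subspace_scale[OF subspace_coord_subspace aP(1)] sumK, of "real (m + C)"] aP
      by (simp_all add: pt_def linear_scale[OF linear_margins])
    ultimately have "pt (m + C) z \<in> lattice_flows F k (m + C)" by (simp add: lattice_flows_def)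
    then have "z \<in> Z (m + C)" by (simp add: Z_def z_def)
    moreover have "t \<in> lattice_cube B s m z" using t m by (auto simp: lattice_cube_iff z_def T spM)
    ultimately show "t \<in> (\<Union>z\<in>Z (m + C). lattice_cube B s m z)" by blast
  qed
  \<comment> \<open>Conversely, flows of height \<open>m\<close> index cubes of side
    \<open>1 / (m + C)\<close>: the added \<open>real C *\<^sub>R a\<close> now keeps the entire
    cube in the polytope.\<close>
  have lower: "(\<Union>z\<in>Z m. lattice_cube B s (m + C) z) \<subseteq> T" if m: "m \<ge> 1" for m
  proof
    fix t assume "t \<in> (\<Union>z\<in>Z m. lattice_cube B s (m + C) z)"
    then obtain z where z: "z \<in> Z m" and t: "t \<in> extensional B"
      "\<And>b. b \<in> B \<Longrightarrow> \<lfloor>real (m + C) * (t b + s b)\<rfloor> = z b"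
      using m by (auto simp: lattice_cube_iff)
    let ?\<theta> = "\<lambda>b. real (m + C) * (t b + s b) - of_int (z b)"
    have pt: "pt (m + C) z = pt m z + real C *\<^sub>R a" by (simp add: pt_def algebra_simps)
    have "(x\<^sub>0 + (\<Sum>b\<in>B. t b *\<^sub>R b)) $ e \<ge> 0" if e: "e \<in> F" for e
    proof -
      have "pt m z $ e \<ge> 0" using z e by (auto simp: Z_def lattice_flows_def)
      moreover have "real C \<le> real C * a $ e" using a1[OF e] mult_left_mono[of 1 "a $ e" "real C"] by simp
      moreover have "\<bar>(\<Sum>b\<in>B. ?\<theta> b *\<^sub>R b) $ e\<bar> \<le> real C" by (rule C) (rule frac[OF t(2)])
      moreover have "real (m + C) * (x\<^sub>0 + (\<Sum>b\<in>B. t b *\<^sub>R b)) $ e = pt (m + C) z $ e + (\<Sum>b\<in>B. ?\<theta> b *\<^sub>R b) $ e"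
        using arg_cong[OF decomp[of "m + C" t z], of "\<lambda>y. y $ e"] by simp
      ultimately have "real (m + C) * (x\<^sub>0 + (\<Sum>b\<in>B. t b *\<^sub>R b)) $ e \<ge> 0" by (simp add: pt)
      moreover have "real (m + C) > 0" using m by simp
      ultimately show ?thesis by (simp only: zero_le_mult_iff) linarith
    qed
    then show "t \<in> T" using t(1) by (simp add: T spM)
  qed
  have cube: "lattice_cube B s m z \<in> sets M" "emeasure M (lattice_cube B s m z) = ennreal ((1 / real m) ^ dim ?K)"
    if "m \<ge> 1" for m z
    using lattice_cube_measure[OF finB that, of s z] unfolding M_def cardB by auto
  have up: "emeasure M T \<le> ennreal (poly p (real m + real C) / real m ^ dim ?K)" if m: "m \<ge> 1" for m
  proof -
    have "emeasure M T \<le> emeasure M (\<Union>z\<in>Z (m + C). lattice_cube B s m z)"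
      using finZ cube(1)[OF m] by (intro emeasure_mono upper[OF m] sets.finite_UN) auto
    also have "\<dots> \<le> (\<Sum>z\<in>Z (m + C). emeasure M (lattice_cube B s m z))"
      using finZ cube(1)[OF m] by (intro emeasure_subadditive_finite) auto
    also have "\<dots> = ennreal (real (card (Z (m + C))) * (1 / real m) ^ dim ?K)"
      by (simp add: cube(2)[OF m] ennreal_mult ennreal_of_nat_eq_real_of_nat)
    also have "real (card (Z (m + C))) * (1 / real m) ^ dim ?K = poly p (real m + real C) / real m ^ dim ?K"
      using p(2)[rule_format, of "m + C"] m by (simp add: cardZ power_divide)
    finally show ?thesis .
  qed
  have low: "ennreal (poly p (real m) / (real m + real C) ^ dim ?K) \<le> emeasure M T" if m: "m \<ge> 1" for m
  proof -
    have mC: "m + C \<ge> 1" using m by simp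
    have "poly p (real m) / (real m + real C) ^ dim ?K = real (card (Z m)) * (1 / real (m + C)) ^ dim ?K"
      using p(2)[rule_format, of m] m by (simp add: cardZ power_divide)
    also have "ennreal \<dots> = (\<Sum>z\<in>Z m. emeasure M (lattice_cube B s (m + C) z))"
      unfolding cube(2)[OF mC] by (simp add: ennreal_mult ennreal_of_nat_eq_real_of_nat)
    also have "\<dots> = emeasure M (\<Union>z\<in>Z m. lattice_cube B s (m + C) z)"
    proof (rule sum_emeasure)
      show "disjoint_family_on (lattice_cube B s (m + C)) (Z m)"
        unfolding disjoint_family_on_def
        by (intro ballI impI lattice_cube_disjoint[OF mC]) (auto simp: Z_def PiE_def)
    qed (use finZ cube(1)[OF mC] in auto)
    also have "\<dots> \<le> emeasure M T" by (rule emeasure_mono[OF lower[OF m] TM])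
    finally show ?thesis .
  qed
  define v where "v = measure M T"
  \<comment> \<open>Finiteness matters, since \<open>measure\<close> would be 0 by default for an
    infinite value.\<close>
  have "emeasure M T \<noteq> \<infinity>" using up[of 1] by (auto simp: top_unique)
  then have v: "emeasure M T = ennreal v" by (simp add: v_def emeasure_eq_ennreal_measure)
  have v0: "v \<ge> 0" by (simp add: v_def)
  have ppos: "poly p (real m) \<ge> 0" if "m \<ge> 1" for m using p(2) that by simp
  have le1: "poly p (real m) / (real m + real C) ^ dim ?K \<le> v" if "m \<ge> 1" for m
    using low[OF that] v0 by (simp add: v)
  have le2: "v \<le> poly p (real m + real C) / (real m + 0) ^ dim ?K" if "m \<ge> 1" for m
  proof -
    have "0 \<le> poly p (real m + real C) / real m ^ dim ?K" using ppos[of "m + C"] that by simp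
    then show ?thesis using up[OF that] by (simp add: v)
  qed
  have "(\<lambda>m. poly p (real m + 0) / (real m + real C) ^ dim ?K) \<longlonglongrightarrow> coeff p (dim ?K)"
    by (rule poly_scaled_limit[OF p(1)])
  then have c1: "coeff p (dim ?K) \<le> v"
    by (rule LIMSEQ_le_const2) (use le1 in auto)
  have "(\<lambda>m. poly p (real m + real C) / (real m + 0) ^ dim ?K) \<longlonglongrightarrow> coeff p (dim ?K)"
    by (rule poly_scaled_limit[OF p(1)])
  then have "v \<le> coeff p (dim ?K)"
    by (rule LIMSEQ_le_const) (use le2 in auto)
  then have vc: "v = coeff p (dim ?K)" using c1 by simp
  show "rel_lattice_volume ?P = coeff p (dim ?K)"
    unfolding rel_lattice_volume_def Let_def B_def[symmetric] x\<^sub>0_def[symmetric] vc[symmetric] v_def M_def T_def ..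
  \<comment> \<open>The lower bound at \<open>m = 1\<close> already counts \<open>a\<close>, so the
    volume is positive and the degree is exactly the dimension.\<close>
  have "a \<in> lattice_flows F k 1" using a aP by (auto simp: lattice_flows_def less_imp_le)
  then have "card (lattice_flows F k 1) > 0" using finite_lattice_flows card_gt_0_iff by blast
  then have "poly p (real 1) > 0" using p(2)[rule_format, of 1] by simp
  then have "0 < poly p (real 1) / (real 1 + real C) ^ dim ?K" by (intro divide_pos_pos) auto
  then show "coeff p (dim ?K) > 0" using le1[of 1] vc by linarith
qed

subsection \<open>The Ehrhart polynomial of the flow polytope\<close>

lemma interior_lattice_flows_eq:
  assumes "a \<in> flow_polytope F k" "\<And>e. e \<in> F \<Longrightarrow> a $ e > 0" "m \<ge> 1"
  shows "rel_interior (dilate m (flow_polytope F k)) \<inter> int_points = interior_lattice_flows F k m"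
proof -
  have "real m *\<^sub>R a \<in> flow_polytope F (\<lambda>i. m * k i)"
    using assms dilate_flow_polytope[of m F k] by (auto simp: dilate_def)
  moreover have "(real m *\<^sub>R a) $ e > 0" if "e \<in> F" for e using assms(2)[OF that] assms(3) by simp
  ultimately have "rel_interior (flow_polytope F (\<lambda>i. m * k i)) = {x \<in> flow_polytope F (\<lambda>i. m * k i). \<forall>e\<in>F. x $ e > 0}"
    using rel_interior_flow_polytope by blast
  then show ?thesis
    unfolding dilate_flow_polytope[OF assms(3)] interior_lattice_flows_def
    by (auto simp: flow_polytope_eq demand_mult less_imp_le)
qed

text \<open>Sums off the diagonal and full sums agree because \<open>F\<close> has no loops, so
  entries supported on \<open>F\<close> vanish on the diagonal.\<close>

lemma pos_flows_iff:
  assumes "F \<subseteq> offdiag_edges"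
  shows "a \<in> pos_flows k F \<longleftrightarrow>
    (\<chi> e. real (a e)) \<in> {x \<in> coord_subspace F. margins x = demand k \<and> (\<forall>e\<in>F. x $ e > 0)}"
proof -
  have "(\<Sum>j | j \<noteq> i. a (j, i)) = (\<Sum>j\<in>UNIV. a (j, i))" "(\<Sum>j | j \<noteq> i. a (i, j)) = (\<Sum>j\<in>UNIV. a (i, j))"
    if "\<forall>e. e \<notin> F \<longrightarrow> a e = 0" for i
  proof -
    have "a (i, i) = 0" using that assms by (auto simp: offdiag_edges_def)
    then show "(\<Sum>j | j \<noteq> i. a (j, i)) = (\<Sum>j\<in>UNIV. a (j, i))" "(\<Sum>j | j \<noteq> i. a (i, j)) = (\<Sum>j\<in>UNIV. a (i, j))"
      by (auto intro!: sum.mono_neutral_left)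
  qed
  moreover have "margins (\<chi> e. real (a e)) = demand k \<longleftrightarrow>
      (\<forall>i. (\<Sum>j\<in>UNIV. a (j, i)) = k i) \<and> (\<forall>j. (\<Sum>i\<in>UNIV. a (j, i)) = k j)"
    unfolding vec_eq_iff split_sum_all by (simp add: margins_Inl margins_Inr demand_def flip: of_nat_sum)
  ultimately show ?thesis
    unfolding pos_flows_def coord_subspace_def by (auto simp del: split_paired_All split_paired_Ex)
qed

lemma nu_eq_card_interior_lattice_flows:
  assumes "F \<subseteq> offdiag_edges"
  shows "nu F k m = card (interior_lattice_flows F k m)"
proof -
  define h where "h = (\<lambda>a :: 'a \<times> 'a \<Rightarrow> nat. (\<chi> e. real (a e)))"
  have "inj_on h (pos_flows (\<lambda>i. m * k i) F)" unfolding h_def by (rule inj_onI) (auto simp: vec_eq_iff)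
  moreover have "h ` pos_flows (\<lambda>i. m * k i) F = interior_lattice_flows F k m"
  proof (intro equalityI subsetI)
    fix x assume "x \<in> h ` pos_flows (\<lambda>i. m * k i) F"
    then show "x \<in> interior_lattice_flows F k m"
      unfolding h_def interior_lattice_flows_def
      using pos_flows_iff[OF assms, of _ "\<lambda>i. m * k i"] by (auto simp: demand_mult int_points_def)
  next
    fix x assume x: "x \<in> interior_lattice_flows F k m"
    define a where "a = (\<lambda>e. nat \<lfloor>x $ e\<rfloor>)"
    have "real (a e) = x $ e" for e
    proof -
      have "x $ e \<ge> 0"
      proof (cases "e \<in> F")
        case False
        then have "x $ e = 0" using x unfolding interior_lattice_flows_def coord_subspace_def by blast
        then show ?thesis by simp
      qed (use x in \<open>auto simp: interior_lattice_flows_def less_imp_le\<close>)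
      moreover obtain z where "x $ e = of_int z"
        using x Ints_cases[OF int_points_nth[of x e]] unfolding interior_lattice_flows_def by blast
      ultimately show ?thesis by (simp add: a_def)
    qed
    then have hx: "h a = x" by (simp add: h_def vec_eq_iff)
    have "h a \<in> {x \<in> coord_subspace F. margins x = demand (\<lambda>i. m * k i) \<and> (\<forall>e\<in>F. x $ e > 0)}"
      unfolding hx demand_mult using x by (simp add: interior_lattice_flows_def)
    then have "a \<in> pos_flows (\<lambda>i. m * k i) F"
      unfolding h_def using pos_flows_iff[OF assms] by blast
    then show "x \<in> h ` pos_flows (\<lambda>i. m * k i) F" using hx by blast
  qed
  ultimately show ?thesis unfolding nu_def by (metis card_image)
qed

theorem theorem6p3:
  fixes k :: "'n::finite \<Rightarrow> nat" and F :: "('n \<times> 'n) set"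
  assumes "CARD('n) \<ge> 2"
    and "\<And>i. k i > 0"
    and "F \<subseteq> offdiag_edges"
    and "mu k F > 0"
  shows "\<exists>p L :: real poly.
    (\<forall>m\<ge>1. real (nu F k m) = poly p (real m)) \<and>
    (\<forall>m\<ge>1. nu F k m = card (rel_interior (dilate m (flow_polytope F k)) \<inter> int_points)) \<and>
    (\<forall>m\<ge>1. poly L (real m) = real (card (dilate m (flow_polytope F k) \<inter> int_points))) \<and>
    int (degree p) = q_dim F \<and>
    (\<forall>m\<ge>1. real (nu F k m) = (-1) powi (q_dim F) * poly L (- real m)) \<and>
    lead_coeff p = rel_lattice_volume (flow_polytope F k) \<and>
    int (degree L) = q_dim F \<and>
    lead_coeff L = rel_lattice_volume (flow_polytope F k)"
proof -
  let ?q = "dim (circulations F)"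
  have "pos_flows k F \<noteq> {}" using assms(4) by (auto simp: mu_def)
  then obtain a' where "a' \<in> pos_flows k F" by blast
  then have "(\<chi> e. real (a' e)) \<in> {x \<in> coord_subspace F. margins x = demand k \<and> (\<forall>e\<in>F. x $ e > 0)}"
    using pos_flows_iff[OF assms(3)] by blast
  moreover have "(\<chi> e. real (a' e)) \<in> int_points" by (simp add: int_points_def)
  ultimately obtain a :: "real ^ ('n \<times> 'n)" where a: "a \<in> int_points" "a \<in> coord_subspace F" "margins a = demand k"
    "\<And>e. e \<in> F \<Longrightarrow> a $ e > 0"
    by blast
  have aP: "a \<in> flow_polytope F k" using a by (simp add: flow_polytope_eq less_imp_le)
  have F: "F \<noteq> {}"
  proof
    assume "F = {}"
    then have "a = 0" using a(2) by (simp add: coord_subspace_def vec_eq_iff)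
    then have "demand k = 0" using a(3) linear_0[OF linear_margins] by metis
    then have "demand k $ Inl i = 0" for i by simp
    then show False using assms(2) by (simp add: demand_def)
  qed
  obtain L :: "real poly" where L: "\<forall>i>?q. coeff L i = 0"
    "\<forall>m\<ge>1. poly L (real m) = real (card (lattice_flows F k m))"
    "\<forall>m\<ge>1. poly L (- real m) = (-1) ^ ?q * real (card (interior_lattice_flows F k m))"
    using lattice_flows_reciprocity[OF F a(2,3,4)] by blast
  have vol: "rel_lattice_volume (flow_polytope F k) = coeff L ?q" "coeff L ?q > 0"
    using flow_polytope_volume[OF aP a(1) _ L(1,2)] a(4) by blast+
  \<comment> \<open>The polynomial \<open>(-1) ^ ?q * L(- x)\<close>; its leading coefficient is
    that of \<open>L\<close>, since the two signs cancel in degree \<open>?q\<close>.\<close>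
  define p where "p = smult ((-1) ^ ?q) (pcompose L [:0, -1:])"
  have p: "poly p x = (-1) ^ ?q * poly L (- x)" for x by (simp add: p_def poly_pcompose)
  have cp: "coeff p i = (-1) ^ ?q * ((-1) ^ i * coeff L i)" for i
    by (simp add: p_def coeff_pcompose_linear)
  have sq: "(-1) ^ ?q * ((-1) ^ ?q * y) = y" for y :: real by (cases "even ?q") simp_all
  have deg: "degree r = ?q" if "\<forall>i>?q. coeff r i = 0" "coeff r ?q > 0" for r :: "real poly"
    using that by (intro antisym degree_le le_degree) auto
  have degL: "degree L = ?q" using deg L(1) vol(2) by blast
  have degp: "degree p = ?q" using L(1) vol(2) by (intro deg) (auto simp: cp sq)
  have q: "q_dim F = int ?q" by (simp add: dim_circulations)
  have nu: "real (nu F k m) = (-1) ^ ?q * poly L (- real m)" if "m \<ge> 1" for m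
    using L(3) that by (simp add: nu_eq_card_interior_lattice_flows[OF assms(3)] sq)
  show ?thesis
  proof (rule exI[of _ p], rule exI[of _ L], intro conjI allI impI)
    fix m :: nat assume m: "1 \<le> m"
    show "real (nu F k m) = poly p (real m)" using nu[OF m] by (simp add: p)
    show "nu F k m = card (rel_interior (dilate m (flow_polytope F k)) \<inter> int_points)"
      using interior_lattice_flows_eq[OF aP a(4) m] nu_eq_card_interior_lattice_flows[OF assms(3)] by simp
    show "poly L (real m) = real (card (dilate m (flow_polytope F k) \<inter> int_points))"
      using L(2) m by (simp add: dilate_flow_polytope_int_points)
    show "real (nu F k m) = (- 1) powi q_dim F * poly L (- real m)"
      using nu[OF m] by (simp add: q)
  qed (simp_all add: degL degp q vol(1) cp sq)
qed

end
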